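(* Consider an oval $\Gamma\in\mathcal{N}$ and let $\phi_0$ be a critical point of its support function $g\in\mathcal{G}$. Then the orbits of the family of $n$-symmetric orbits associated to $\phi_0$ are elliptic (respectively hyperbolic) if and only if $\phi_0$ is a non-degenerate minimum (respectively maximum) of $g$.
   Context: Fix an integer $n\ge 2$. An oval is a regular, closed, $C^\infty$ plane curve with strictly positive curvature, parametrized by the angle $\phi\in\mathbb{R}/2\pi\mathbb{Z}$ between its tangent vector $\sigma(\phi)=(\cos\phi,\sin\phi)$ and the positive horizontal axis. It is $n$-symmetric if it is invariant under the rotation by $\frac{2\pi}{n}$ around a point (the symmetry center), taken to be the origin. $\mathcal{N}$ denotes the set of $C^\infty$ $n$-symmetric ovals with symmetry center at the origin. With $\eta(\phi)=(-\sin\phi,\cos\phi)$ the inward normal, the support function of $\Gamma$ is $g(\phi)=-\langle\Gamma(\phi),\eta(\phi)\rangle$, and $R=g+g''$ is the radius of curvature. With $S_n=\mathbb{R}/\frac{2\pi}{n}\mathbb{Z}$, the map $\Gamma\mapsto g$ is a bijection from $\mathcal{N}$ onto $\mathcal{G}=\{g\in C^\infty(S_n,\mathbb{R}): g>0,\ g+g''>0\}$. Billiard map: a particle moves at constant speed along straight segments inside the region bounded by $\Gamma$ and reflects elastically at $\Gamma$. A collision is described by $(\phi,p)$, where $\Gamma(\phi)$ is the impact point and $p=\cos\alpha$ with $\alpha\in(0,\pi)$ the outgoing angle measured from $\sigma(\phi)$. The billiard map $T$ on $\Omega=\mathbb{R}/2\pi\mathbb{Z}\times(-1,1)$ sends each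 collision to the next. Let $\phi_0\in S_n$ be a critical point of $g$. The family of $n$-symmetric orbits associated to $\phi_0$ is the set of $T$-orbits of the points $(\phi_k,p_m)$, $m=1,\dots,n-1$, $k=0,\dots,\gcd(n,m)-1$, where $\phi_k=\phi_0+\frac{2k\pi}{n}$ and $p_m=\cos\frac{m\pi}{n}$; these orbits are periodic of period $n/\gcd(n,m)$. For $1\le m\le n-1$, $T$ commutes with $\phi\mapsto\phi+\frac{2m\pi}{n}$ and so induces the $m$-quotient map $T_m$ on the quotient of $\Omega$ by the equivalence relation generated by $(\phi,p)\sim_m(\phi+\frac{2m\pi}{n},p)$. Each $(\phi_k,p_m)$ is a fixed point of $T_m$. By convention, the orbit of $(\phi_k,p_m)$ is called elliptic (hyperbolic) if this fixed point of $T_m$ is elliptic, i.e. $DT_m$ there has non-real eigenvalues of modulus 1 (hyperbolic, i.e. $DT_m$ there has real eigenvalues of modulus $\neq1$). A minimum (maximum) means a local one; it is non-degenerate if $g''\ne0$ there. *)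

theory Defs
  imports "HOL-Analysis.Analysis" "Jordan_Normal_Form.Char_Poly"
begin

text \<open>
  The plane is \<^typ>\<open>complex\<close>; functions on \<open>\<real>/2\<pi>\<int>\<close> and on \<open>\<real>/(2\<pi>/n)\<int>\<close> are
  periodic functions on \<^typ>\<open>real\<close>.
\<close>

definition tangent :: "real \<Rightarrow> complex" where
  "tangent \<phi> = cis \<phi>"

definition inward_normal :: "real \<Rightarrow> complex" where
  "inward_normal \<phi> = Complex (- sin \<phi>) (cos \<phi>)"

definition smooth_curve :: "(real \<Rightarrow> complex) \<Rightarrow> bool" where
  "smooth_curve \<Gamma> \<longleftrightarrow>
     (\<forall>k t. ((\<lambda>f s. vector_derivative f (at s)) ^^ k) \<Gamma> differentiable (at t))"

text \<open>Signed curvature \<open>det (\<Gamma>', \<Gamma>'') / |\<Gamma>'|\<^sup>3\<close>.\<close>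

definition curvature :: "(real \<Rightarrow> complex) \<Rightarrow> real \<Rightarrow> real" where
  "curvature \<Gamma> t =
     (let d1 = vector_derivative \<Gamma> (at t);
          d2 = vector_derivative (\<lambda>s. vector_derivative \<Gamma> (at s)) (at t)
      in (Re d1 * Im d2 - Im d1 * Re d2) / norm d1 ^ 3)"

text \<open>
  The fourth and fifth conditions say that \<open>\<Gamma>\<close> is regular and that its parameter is the angle
  of its tangent. Simplicity of the curve follows.
\<close>

definition oval :: "(real \<Rightarrow> complex) \<Rightarrow> bool" where
  "oval \<Gamma> \<longleftrightarrow>
     smooth_curve \<Gamma> \<and>
     (\<forall>\<phi>. \<Gamma> (\<phi> + 2 * pi) = \<Gamma> \<phi>) \<and>
     (\<forall>\<phi>. curvature \<Gamma> \<phi> > 0) \<and>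
     (\<forall>\<phi>. vector_derivative \<Gamma> (at \<phi>) \<noteq> 0) \<and>
     (\<forall>\<phi>. vector_derivative \<Gamma> (at \<phi>) = norm (vector_derivative \<Gamma> (at \<phi>)) *\<^sub>R tangent \<phi>)"

definition symmetric_ovals :: "nat \<Rightarrow> (real \<Rightarrow> complex) set" where
  "symmetric_ovals n =
     {\<Gamma>. oval \<Gamma> \<and> (\<lambda>z. cis (2 * pi / real n) * z) ` range \<Gamma> = range \<Gamma>}"

definition support_fun :: "(real \<Rightarrow> complex) \<Rightarrow> real \<Rightarrow> real" where
  "support_fun \<Gamma> \<phi> = - inner (\<Gamma> \<phi>) (inward_normal \<phi>)"

definition critical_point :: "(real \<Rightarrow> real) \<Rightarrow> real \<Rightarrow> bool" where
  "critical_point g x \<longleftrightarrow> (g has_real_derivative 0) (at x)"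

definition nondegenerate_minimum :: "(real \<Rightarrow> real) \<Rightarrow> real \<Rightarrow> bool" where
  "nondegenerate_minimum g x \<longleftrightarrow>
     (\<forall>\<^sub>F y in nhds x. g x \<le> g y) \<and> deriv (deriv g) x \<noteq> 0"

definition nondegenerate_maximum :: "(real \<Rightarrow> real) \<Rightarrow> real \<Rightarrow> bool" where
  "nondegenerate_maximum g x \<longleftrightarrow>
     (\<forall>\<^sub>F y in nhds x. g y \<le> g x) \<and> deriv (deriv g) x \<noteq> 0"


section \<open>The billiard map\<close>

text \<open>
  The particle leaves \<open>\<Gamma>(\<phi>)\<close> in direction \<open>v\<close>, at angle \<open>arccos p\<close> from the tangent, and first
  meets the curve again at \<open>\<Gamma>(\<phi>')\<close>. There \<open>v\<close> is reflected in the tangent line, and the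
  reflected direction makes the angle \<open>arccos p'\<close> with the tangent.
\<close>

definition next_collision :: "(real \<Rightarrow> complex) \<Rightarrow> real \<times> real \<Rightarrow> real \<times> real \<Rightarrow> bool" where
  "next_collision \<Gamma> x x' \<longleftrightarrow>
     (case (x, x') of ((\<phi>, p), (\<phi>', p')) \<Rightarrow>
        p \<in> {-1<..<1} \<and> p' \<in> {-1<..<1} \<and>
        (let v = cis (\<phi> + arccos p) in
           (\<exists>t>0. \<Gamma> \<phi>' = \<Gamma> \<phi> + t *\<^sub>R v \<and> (\<forall>s\<in>{0<..<t}. \<Gamma> \<phi> + s *\<^sub>R v \<notin> range \<Gamma>)) \<and>
           cis (\<phi>' + arccos p') = v - (2 * inner v (inward_normal \<phi>')) *\<^sub>R inward_normal \<phi>'))"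

text \<open>
  A point of the phase cylinder \<open>\<Omega> = \<real>/2\<pi>\<int> \<times> (-1,1)\<close> is a pair \<open>(u, p)\<close> with \<open>u\<close> on the unit
  circle, \<open>cis \<phi>\<close> standing for the class of \<open>\<phi>\<close> modulo \<open>2\<pi>\<close>.
\<close>

type_synonym phase = "complex \<times> real"

definition phase_of :: "real \<times> real \<Rightarrow> phase" where
  "phase_of x = (cis (fst x), snd x)"

definition billiard_map :: "(real \<Rightarrow> complex) \<Rightarrow> phase \<Rightarrow> phase" where
  "billiard_map \<Gamma> z =
     (THE z'. \<exists>x x'. z = phase_of x \<and> z' = phase_of x' \<and> next_collision \<Gamma> x x')"

text \<open>The equivalence relation generated by \<open>(\<phi>, p) \<sim> (\<phi> + 2m\<pi>/n, p)\<close>.\<close>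

definition quot_equiv :: "nat \<Rightarrow> nat \<Rightarrow> phase \<Rightarrow> phase \<Rightarrow> bool" where
  "quot_equiv n m =
     equivclp (\<lambda>z z'. z' = (cis (2 * real m * pi / real n) * fst z, snd z))"

definition quot_class :: "nat \<Rightarrow> nat \<Rightarrow> phase \<Rightarrow> phase set" where
  "quot_class n m z = Collect (quot_equiv n m z)"

definition quotient_map :: "(real \<Rightarrow> complex) \<Rightarrow> nat \<Rightarrow> nat \<Rightarrow> phase set \<Rightarrow> phase set" where
  "quotient_map \<Gamma> n m X = (\<Union>z\<in>X. quot_class n m (billiard_map \<Gamma> z))"


section \<open>Fixed points of the quotient maps\<close>

text \<open>
  The map \<open>quot_class n m \<circ> phase_of\<close> restricts to a covering of \<open>\<Omega>/\<sim>\<close> by \<open>\<real> \<times> (-1,1)\<close>, whose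
  deck transformations are translations in \<open>\<phi>\<close>; its local inverses are the charts of \<open>\<Omega>/\<sim>\<close>.
  Below, \<open>F\<close> is the quotient map read in the chart around the class of \<open>x\<close> whose values are
  near \<open>x\<close>; in particular that class is a fixed point. As \<open>F\<close> is continuous at \<open>x\<close>, it is
  determined near \<open>x\<close>, and hence so is \<open>D\<close>.
\<close>

definition quotient_derivative ::
  "(real \<Rightarrow> complex) \<Rightarrow> nat \<Rightarrow> nat \<Rightarrow> real \<times> real \<Rightarrow> (real \<times> real \<Rightarrow> real \<times> real) \<Rightarrow> bool" where
  "quotient_derivative \<Gamma> n m x D \<longleftrightarrow>
     (\<exists>F. F x = x \<and>
          (\<forall>\<^sub>F y in nhds x.
             quot_class n m (phase_of (F y)) = quotient_map \<Gamma> n m (quot_class n m (phase_of y))) \<and>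
          (F has_derivative D) (at x))"

definition complex_matrix :: "(real \<times> real \<Rightarrow> real \<times> real) \<Rightarrow> complex mat" where
  "complex_matrix D = mat_of_rows_list 2
     [[complex_of_real (fst (D (1, 0))), complex_of_real (fst (D (0, 1)))],
      [complex_of_real (snd (D (1, 0))), complex_of_real (snd (D (0, 1)))]]"

definition elliptic_fixed_point ::
  "(real \<Rightarrow> complex) \<Rightarrow> nat \<Rightarrow> nat \<Rightarrow> real \<times> real \<Rightarrow> bool" where
  "elliptic_fixed_point \<Gamma> n m x \<longleftrightarrow>
     (\<exists>D. quotient_derivative \<Gamma> n m x D \<and>
          (\<forall>\<mu>. eigenvalue (complex_matrix D) \<mu> \<longrightarrow> \<mu> \<notin> \<real> \<and> norm \<mu> = 1))"

definition hyperbolic_fixed_point ::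
  "(real \<Rightarrow> complex) \<Rightarrow> nat \<Rightarrow> nat \<Rightarrow> real \<times> real \<Rightarrow> bool" where
  "hyperbolic_fixed_point \<Gamma> n m x \<longleftrightarrow>
     (\<exists>D. quotient_derivative \<Gamma> n m x D \<and>
          (\<forall>\<mu>. eigenvalue (complex_matrix D) \<mu> \<longrightarrow> \<mu> \<in> \<real> \<and> norm \<mu> \<noteq> 1))"


section \<open>The family of symmetric orbits\<close>

definition orbit_index :: "nat \<Rightarrow> (nat \<times> nat) set" where
  "orbit_index n = {(m, k). 1 \<le> m \<and> m \<le> n - 1 \<and> k < gcd n m}"

definition orbit_point :: "nat \<Rightarrow> real \<Rightarrow> nat \<Rightarrow> nat \<Rightarrow> real \<times> real" where
  "orbit_point n \<phi>\<^sub>0 m k = (\<phi>\<^sub>0 + 2 * real k * pi / real n, cos (real m * pi / real n))"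

definition billiard_orbit :: "(real \<Rightarrow> complex) \<Rightarrow> phase \<Rightarrow> phase set" where
  "billiard_orbit \<Gamma> z = {(billiard_map \<Gamma> ^^ i) z | i. True}"

definition symmetric_orbits :: "(real \<Rightarrow> complex) \<Rightarrow> nat \<Rightarrow> real \<Rightarrow> phase set set" where
  "symmetric_orbits \<Gamma> n \<phi>\<^sub>0 =
     {billiard_orbit \<Gamma> (phase_of (orbit_point n \<phi>\<^sub>0 m k)) | m k. (m, k) \<in> orbit_index n}"

definition elliptic_orbit ::
  "(real \<Rightarrow> complex) \<Rightarrow> nat \<Rightarrow> real \<Rightarrow> phase set \<Rightarrow> bool" where
  "elliptic_orbit \<Gamma> n \<phi>\<^sub>0 orb \<longleftrightarrow>
     (\<exists>(m, k) \<in> orbit_index n.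
        orb = billiard_orbit \<Gamma> (phase_of (orbit_point n \<phi>\<^sub>0 m k)) \<and>
        elliptic_fixed_point \<Gamma> n m (orbit_point n \<phi>\<^sub>0 m k))"

definition hyperbolic_orbit ::
  "(real \<Rightarrow> complex) \<Rightarrow> nat \<Rightarrow> real \<Rightarrow> phase set \<Rightarrow> bool" where
  "hyperbolic_orbit \<Gamma> n \<phi>\<^sub>0 orb \<longleftrightarrow>
     (\<exists>(m, k) \<in> orbit_index n.
        orb = billiard_orbit \<Gamma> (phase_of (orbit_point n \<phi>\<^sub>0 m k)) \<and>
        hyperbolic_fixed_point \<Gamma> n m (orbit_point n \<phi>\<^sub>0 m k))"

end

theory Submission
  imports Defs
begin

text \<open>
  Write \<open>\<Gamma>' = \<rho> \<sigma>\<close>, so that \<open>g' = \<langle>\<Gamma>, \<sigma>\<rangle>\<close> and \<open>g'' = \<rho> - g\<close>. The chord leaving \<open>\<Gamma>(\<phi>)\<close> at angle \<open>\<beta>\<close>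
  ends at the zero of \<open>s \<mapsto> \<langle>\<Gamma>(s) - \<Gamma>(\<phi>), \<eta>(\<beta>)\<rangle>\<close>, whose derivative \<open>\<rho>(s) sin (s - \<beta>)\<close> has known signs;
  this makes the billiard map explicit. At a critical point of \<open>g\<close> the position \<open>\<Gamma> = - g \<eta>\<close> is normal
  to the curve and the chord to its rotation by \<open>2\<alpha> = 2m\<pi>/n\<close> has length \<open>2 g sin \<alpha>\<close>. With
  \<open>r = \<rho> / (2 g)\<close> the derivative of \<open>T\<^sub>m\<close> there has determinant \<open>1\<close> and both diagonal entries
  \<open>(1 - r) / r\<close>. So it is elliptic iff \<open>r > 1/2\<close>, i.e. \<open>g'' > 0\<close>, and hyperbolic iff \<open>g'' < 0\<close>.
\<close>

section \<open>Rotating frames\<close>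

lemma inner_cis_cis: "inner (cis a) (cis b) = cos (a - b)"
  by (simp add: inner_complex_def cos_diff)

lemma inner_cis_inward_normal: "inner (cis a) (inward_normal b) = sin (a - b)"
  by (simp add: inner_complex_def inward_normal_def sin_diff)

lemma inward_normal_eq: "inward_normal a = \<i> * cis a"
  by (simp add: inward_normal_def complex_eq_iff)

lemma inner_rotate: "inner (cis a * z) (cis a * w) = inner z w"
proof -
  have "(c * x - s * y) * (c * u - s * v) + (c * y + s * x) * (c * v + s * u)
      = (s\<^sup>2 + c\<^sup>2) * (x * u + y * v)" for c s x y u v :: real
    by (simp add: power2_eq_square algebra_simps)
  from this[of "cos a" "Re z" "sin a" "Im z" "Re w" "Im w"] show ?thesis
    by (simp add: inner_complex_def)
qed

lemma inward_normal_add: "inward_normal (a + b) = cis b * inward_normal a"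
  by (simp add: inward_normal_eq cis_mult mult.left_commute add.commute)

lemma cis_eqE:
  assumes "cis a = cis b"
  obtains j :: int where "a = b + 2 * pi * j"
  using assms sin_cos_eq_iff[of a b] by (auto simp: complex_eq_iff)

lemma cis_add_2pi_int: "cis (a + 2 * pi * of_int j) = cis a"
  by (metis cis_cnj cis_divide cis_multiple_2pi Ints_of_int cis_mult mult_1_right)

lemma inward_normal_add_2pi_int: "inward_normal (a + 2 * pi * of_int j) = inward_normal a"
  by (simp add: inward_normal_eq cis_add_2pi_int)

text \<open>Reflection in a line negates the angle to that line. This turns the reflection law of
  \<open>next_collision\<close> into an equation between angles.\<close>

lemma cis_reflect:
  "cis b - (2 * inner (cis b) (inward_normal a)) *\<^sub>R inward_normal a = cis (2 * a - b)"
proof -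
  define d where "d = b - a"
  have b: "b = a + d" and "2 * a - b = a - d"
    by (simp_all add: d_def)
  then show ?thesis
    by (simp only: inner_cis_inward_normal)
       (simp add: inward_normal_def complex_eq_iff sin_add cos_add sin_diff cos_diff)
qed

lemma orthonormal_decomposition:
  "inner z (cis a) *\<^sub>R cis a + inner z (inward_normal a) *\<^sub>R inward_normal a = z"
proof -
  have "(x * c + y * s) * c + (y * c - x * s) * - s = (s\<^sup>2 + c\<^sup>2) * x"
    "(x * c + y * s) * s + (y * c - x * s) * c = (s\<^sup>2 + c\<^sup>2) * y" for x y s c :: real
    by (simp_all add: power2_eq_square algebra_simps)
  from this[of "Re z" "cos a" "Im z" "sin a"] show ?thesis
    by (simp add: inner_complex_def inward_normal_def complex_eq_iff)
qed

lemma mod_2pi: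
  obtains j :: int and s' where "s = s' + 2 * pi * j" "\<phi> \<le> s'" "s' < \<phi> + 2 * pi"
proof
  define j where "j = \<lfloor>(s - \<phi>) / (2 * pi)\<rfloor>"
  have "of_int j \<le> (s - \<phi>) / (2 * pi)" "(s - \<phi>) / (2 * pi) < of_int j + 1"
    unfolding j_def by linarith+
  then show "s = (s - 2 * pi * j) + 2 * pi * j" "\<phi> \<le> s - 2 * pi * j" "s - 2 * pi * j < \<phi> + 2 * pi"
    by (simp_all add: field_simps)
qed

text \<open>The quotient rule for the cosine of the angle between a chord \<open>C\<close> and a
  moving direction \<open>a\<close>: the length of \<open>C\<close> changes by the component of
  \<open>C'\<close> along \<open>cis b\<close>, and turning \<open>a\<close> contributes the sine
  term. It serves for the tangent at either end of a chord.\<close>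

lemma direction_cos_derivative:
  fixes C :: "'a::real_normed_vector \<Rightarrow> complex" and a :: "'a \<Rightarrow> real"
  assumes C: "(C has_derivative C') (at x)" and a: "(a has_derivative a') (at x)"
    and Cx: "C x = l *\<^sub>R cis b" "l > 0"
  shows "((\<lambda>y. inner (C y) (cis (a y)) / norm (C y)) has_derivative
    (\<lambda>h. (inner (C' h) (cis (a x)) - cos (b - a x) * inner (C' h) (cis b)) / l
      + sin (b - a x) * a' h)) (at x)"
proof -
  have norm_Cx: "norm (C x) = l" and nz: "C x \<noteq> 0"
    using Cx by auto
  have sgn_Cx: "sgn (C x) = cis b"
    using Cx by (simp add: sgn_scaleR sgn_div_norm)
  have N: "((\<lambda>y. norm (C y)) has_derivative (\<lambda>h. inner (C' h) (cis b))) (at x)"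
    using has_derivative_compose[OF C has_derivative_norm[OF nz]] by (simp add: sgn_Cx)
  have I: "((\<lambda>y. inner (C y) (cis (a y))) has_derivative
      (\<lambda>h. inner (C x) (a' h *\<^sub>R (\<i> * cis (a x))) + inner (C' h) (cis (a x)))) (at x)"
    by (rule has_derivative_inner[OF C has_derivative_cis[OF a]])
  show ?thesis
    by (rule has_derivative_eq_rhs[OF has_derivative_divide'[OF I N]])
      (use Cx in \<open>auto simp: norm_Cx fun_eq_iff inner_cis_cis field_simps
        inner_cis_inward_normal simp flip: inward_normal_eq\<close>)
qed

section \<open>The quotient of the phase cylinder\<close>

text \<open>A step of the generating relation, taken forwards or backwards, changes the exponent
  \<open>j\<close> by 1 or -1, so the classes are the orbits of a cyclic rotation group.\<close>

lemma quot_equiv_iff: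
  "quot_equiv n m z w \<longleftrightarrow>
     (\<exists>j::int. w = (cis (2 * real m * pi / real n * of_int j) * fst z, snd z))"
proof
  assume "quot_equiv n m z w"
  then show "\<exists>j::int. w = (cis (2 * real m * pi / real n * of_int j) * fst z, snd z)"
    unfolding quot_equiv_def
  proof (induction rule: equivclp_induct)
    case base
    show ?case
      by (rule exI[of _ 0]) simp
  next
    case (step u w)
    define \<theta> where "\<theta> = 2 * real m * pi / real n"
    from step.IH obtain j :: int where j: "u = (cis (\<theta> * of_int j) * fst z, snd z)"
      by (auto simp: \<theta>_def)
    have "w = (cis (\<theta> * of_int i + \<theta> * of_int j) * fst z, snd z)" if "w = (cis (\<theta> * of_int i) * fst u, snd u)" for i
      unfolding that j by (simp add: mult.assoc flip: cis_mult)
    moreover from step.hyps(2) have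
      "w = (cis (\<theta> * of_int 1) * fst u, snd u) \<or> w = (cis (\<theta> * of_int (- 1)) * fst u, snd u)"
      by (auto simp: prod_eq_iff cis_mult mult.assoc[symmetric] \<theta>_def)
    ultimately have "\<exists>i. w = (cis (\<theta> * of_int i + \<theta> * of_int j) * fst z, snd z)"
      by blast
    then have "\<exists>i. w = (cis (\<theta> * of_int (i + j)) * fst z, snd z)"
      by (simp only: of_int_add distrib_left)
    then show ?case
      unfolding \<theta>_def[symmetric] by blast
  qed
next
  define \<theta> where "\<theta> = 2 * real m * pi / real n"
  define R where "R = (\<lambda>z w::phase. w = (cis \<theta> * fst z, snd z))"
  have nat: "equivclp R z (cis (\<theta> * of_nat k) * fst z, snd z)" for z k
  proof (induction k)
    case (Suc k)
    have "R (cis (\<theta> * of_nat k) * fst z, snd z) (cis (\<theta> * of_nat (Suc k)) * fst z, snd z)"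
      by (simp add: R_def cis_mult distrib_left mult.assoc[symmetric])
    with Suc show ?case
      by (blast intro: equivclp_into_equivclp)
  qed simp
  assume "\<exists>j::int. w = (cis (2 * real m * pi / real n * of_int j) * fst z, snd z)"
  then obtain j :: int where j: "w = (cis (\<theta> * of_int j) * fst z, snd z)"
    by (auto simp: \<theta>_def)
  have "equivclp R z w"
  proof (cases "j \<ge> 0")
    case True
    then show ?thesis
      using nat[of z "nat j"] by (simp add: j)
  next
    case False
    \<comment> \<open>For negative \<open>j\<close> the chain of steps runs from \<open>w\<close> to
      \<open>z\<close>, and symmetry reverses it.\<close>
    have "z = (cis (\<theta> * of_nat (nat (- j))) * fst w, snd w)"
      using False by (simp add: j cis_mult flip: mult.assoc)
    then show ?thesis
      using nat[of w "nat (- j)"] by (metis equivclp_sym)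
  qed
  then show "quot_equiv n m z w"
    by (simp add: quot_equiv_def R_def \<theta>_def)
qed

lemma quot_class_eq_iff: "quot_class n m z = quot_class n m w \<longleftrightarrow> quot_equiv n m z w"
proof -
  have "equivp (quot_equiv n m)"
    unfolding quot_equiv_def by simp
  then show ?thesis
    using equivp_def[of "quot_equiv n m"] by (metis quot_class_def Collect_inj)
qed

lemma quot_equiv_phase_of:
  "quot_equiv n m (phase_of x) w \<longleftrightarrow>
     (\<exists>j::int. w = phase_of (fst x + 2 * real m * pi / real n * of_int j, snd x))"
  unfolding quot_equiv_iff by (simp add: phase_of_def cis_mult add.commute)

text \<open>The relation compares angles modulo \<open>2 * m * pi / n\<close> and \<open>cis\<close>
  modulo \<open>2 * pi\<close>; both are multiples of \<open>2 * pi / n\<close>. This discreteness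
  separates different local lifts.\<close>

lemma quot_equiv_phase_ofD:
  assumes "n > 0" "quot_equiv n m (phase_of x) (phase_of y)"
  obtains j :: int where "fst y - fst x = 2 * pi / real n * of_int j" "snd y = snd x"
proof -
  obtain j :: int where j: "phase_of y = phase_of (fst x + 2 * real m * pi / real n * of_int j, snd x)"
    using assms(2) by (auto simp: quot_equiv_phase_of)
  then have "cis (fst y) = cis (fst x + 2 * real m * pi / real n * of_int j)"
    by (simp add: phase_of_def)
  then obtain i :: int where
    "fst y = fst x + 2 * real m * pi / real n * of_int j + 2 * pi * of_int i"
    by (rule cis_eqE)
  then have "fst y - fst x = 2 * pi / real n * of_int (int m * j + int n * i)"
    using assms(1) by (simp add: field_simps)
  then show ?thesis
    using j by (intro that[of "int m * j + int n * i"]) (auto simp: phase_of_def)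
qed

text \<open>
  Two local lifts of the quotient map differ by elements of the discrete group \<open>(2\<pi>/n)\<int>\<close> and agree
  at \<open>x\<close>, so by continuity they agree near \<open>x\<close>.
\<close>

lemma quotient_derivative_unique:
  assumes "n > 0" "quotient_derivative \<Gamma> n m x D" "quotient_derivative \<Gamma> n m x E"
  shows "D = E"
proof -
  obtain F where F: "F x = x" "(F has_derivative D) (at x)"
    "\<forall>\<^sub>F y in nhds x. quot_class n m (phase_of (F y)) = quotient_map \<Gamma> n m (quot_class n m (phase_of y))"
    using assms(2) unfolding quotient_derivative_def by blast
  obtain G where G: "G x = x" "(G has_derivative E) (at x)"
    "\<forall>\<^sub>F y in nhds x. quot_class n m (phase_of (G y)) = quotient_map \<Gamma> n m (quot_class n m (phase_of y))"
    using assms(3) unfolding quotient_derivative_def by blast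
  have "isCont (\<lambda>y. fst (G y) - fst (F y)) x"
    using has_derivative_continuous[OF F(2)] has_derivative_continuous[OF G(2)]
    by (intro continuous_intros)
  then have "((\<lambda>y. fst (G y) - fst (F y)) \<longlongrightarrow> 0) (at x)"
    using F(1) G(1) by (simp add: isCont_def)
  then have "\<forall>\<^sub>F y in at x. \<bar>fst (G y) - fst (F y)\<bar> < 2 * pi / real n"
    using assms(1) by (auto dest!: tendstoD[of _ _ _ "2 * pi / real n"] simp: dist_real_def)
  moreover have "\<forall>\<^sub>F y in at x. quot_equiv n m (phase_of (F y)) (phase_of (G y))"
  proof -
    have "\<forall>\<^sub>F y in nhds x. quot_equiv n m (phase_of (F y)) (phase_of (G y))"
      using F(3) G(3) by eventually_elim (simp flip: quot_class_eq_iff)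
    then show ?thesis
      by (simp add: eventually_nhds_conv_at)
  qed
  ultimately have "\<forall>\<^sub>F y in at x. F y = G y"
  proof eventually_elim
    case (elim y)
    obtain j :: int where j: "fst (G y) - fst (F y) = 2 * pi / real n * of_int j"
      "snd (G y) = snd (F y)"
      using assms(1) elim(2) by (rule quot_equiv_phase_ofD)
    have "2 * pi / real n * \<bar>of_int j\<bar> < 2 * pi / real n * 1"
      using elim(1) assms(1) by (simp add: j abs_mult)
    then have "\<bar>real_of_int j\<bar> < 1"
      using assms(1) by (subst (asm) mult_less_cancel_left_pos) auto
    then have "j = 0"
      by linarith
    with j show ?case
      by (simp add: prod_eq_iff)
  qed
  then have "(G has_derivative D) (at x)"
    using has_derivative_transform_eventually[OF F(2)] F(1) G(1) by simp
  then show ?thesis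
    using G(2) has_derivative_unique by blast
qed

section \<open>Eigenvalues and the second derivative test\<close>

text \<open>Eliminating a coordinate of an eigenvector gives the characteristic equation;
  conversely, each root comes with an explicit eigenvector.\<close>

lemma eigenvalue_complex_matrix:
  "eigenvalue (complex_matrix D) \<mu> \<longleftrightarrow>
     (\<mu> - of_real (fst (D (1, 0)))) * (\<mu> - of_real (snd (D (0, 1))))
       = of_real (fst (D (0, 1)) * snd (D (1, 0)))" (is "_ \<longleftrightarrow> ?R")
proof -
  define a b c d where abcd: "a = complex_of_real (fst (D (1, 0)))"
    "b = complex_of_real (fst (D (0, 1)))" "c = complex_of_real (snd (D (1, 0)))"
    "d = complex_of_real (snd (D (0, 1)))"
  define A where "A = complex_matrix D"
  have carrier: "A \<in> carrier_mat 2 2"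
    unfolding A_def complex_matrix_def by (auto simp: mat_of_rows_list_def)
  have entries: "A $$ (0, 0) = a" "A $$ (0, 1) = b" "A $$ (1, 0) = c" "A $$ (1, 1) = d"
    by (simp_all add: A_def complex_matrix_def mat_of_rows_list_def abcd)
  have vec_eq: "v = w \<longleftrightarrow> v $ 0 = w $ 0 \<and> v $ 1 = w $ 1"
    if "v \<in> carrier_vec 2" "w \<in> carrier_vec 2" for v w :: "complex vec"
    using that by (auto intro!: eq_vecI simp: less_2_cases_iff)
  have mult: "(A *\<^sub>v v) $ 0 = a * v $ 0 + b * v $ 1" "(A *\<^sub>v v) $ 1 = c * v $ 0 + d * v $ 1"
    if "v \<in> carrier_vec 2" for v
    using that carrier entries by (simp_all add: scalar_prod_def numeral_2_eq_2)
  have eigen: "A *\<^sub>v v = \<mu> \<cdot>\<^sub>v v \<longleftrightarrow>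
      a * v $ 0 + b * v $ 1 = \<mu> * v $ 0 \<and> c * v $ 0 + d * v $ 1 = \<mu> * v $ 1"
    if "v \<in> carrier_vec 2" for v
    using that carrier by (subst vec_eq) (auto simp: mult simp del: index_mult_mat_vec One_nat_def)
  have "eigenvalue A \<mu> \<longleftrightarrow> (\<exists>v. v \<in> carrier_vec 2 \<and> v \<noteq> 0\<^sub>v 2 \<and> A *\<^sub>v v = \<mu> \<cdot>\<^sub>v v)"
    using carrier by (auto simp: eigenvalue_def eigenvector_def)
  also have "\<dots> \<longleftrightarrow> (\<exists>x y. (x \<noteq> 0 \<or> y \<noteq> 0) \<and> a * x + b * y = \<mu> * x \<and> c * x + d * y = \<mu> * y)"
  proof
    assume "\<exists>v. v \<in> carrier_vec 2 \<and> v \<noteq> 0\<^sub>v 2 \<and> A *\<^sub>v v = \<mu> \<cdot>\<^sub>v v"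
    then obtain v where v: "v \<in> carrier_vec 2" "v \<noteq> 0\<^sub>v 2" "A *\<^sub>v v = \<mu> \<cdot>\<^sub>v v"
      by blast
    then have "v $ 0 \<noteq> 0 \<or> v $ 1 \<noteq> 0"
      using vec_eq[OF v(1) zero_carrier_vec] by auto
    with v eigen show "\<exists>x y. (x \<noteq> 0 \<or> y \<noteq> 0) \<and> a * x + b * y = \<mu> * x \<and> c * x + d * y = \<mu> * y"
      by blast
  next
    assume "\<exists>x y. (x \<noteq> 0 \<or> y \<noteq> 0) \<and> a * x + b * y = \<mu> * x \<and> c * x + d * y = \<mu> * y"
    then obtain x y where xy: "x \<noteq> 0 \<or> y \<noteq> 0" "a * x + b * y = \<mu> * x" "c * x + d * y = \<mu> * y"
      by blast
    define v where "v = vec 2 (\<lambda>i. if i = 0 then x else y)"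
    have v: "v \<in> carrier_vec 2" "v $ 0 = x" "v $ 1 = y"
      by (simp_all add: v_def)
    then have "v \<noteq> 0\<^sub>v 2"
      using vec_eq[OF v(1) zero_carrier_vec] xy(1) by auto
    moreover have "A *\<^sub>v v = \<mu> \<cdot>\<^sub>v v"
      using eigen[OF v(1)] xy v by simp
    ultimately show "\<exists>v. v \<in> carrier_vec 2 \<and> v \<noteq> 0\<^sub>v 2 \<and> A *\<^sub>v v = \<mu> \<cdot>\<^sub>v v"
      using v(1) by blast
  qed
  also have "\<dots> \<longleftrightarrow> (\<mu> - a) * (\<mu> - d) = b * c"
  proof
    assume "\<exists>x y. (x \<noteq> 0 \<or> y \<noteq> 0) \<and> a * x + b * y = \<mu> * x \<and> c * x + d * y = \<mu> * y"
    then obtain x y where xy: "x \<noteq> 0 \<or> y \<noteq> 0" "a * x + b * y = \<mu> * x" "c * x + d * y = \<mu> * y"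
      by blast
    then have by_cx: "b * y = (\<mu> - a) * x" "c * x = (\<mu> - d) * y"
      by (simp_all add: algebra_simps)
    \<comment> \<open>The equation is obtained multiplied by \<open>x\<close> and then by
      \<open>y\<close>; a nonzero coordinate can be cancelled.\<close>
    have "(\<mu> - a) * (\<mu> - d) * x = (\<mu> - d) * ((\<mu> - a) * x)"
      by (simp only: mult_ac)
    also have "\<dots> = b * ((\<mu> - d) * y)"
      unfolding by_cx(1)[symmetric] by (simp only: mult_ac)
    also have "\<dots> = b * c * x"
      unfolding by_cx(2)[symmetric] by (simp only: mult_ac)
    finally have "(\<mu> - a) * (\<mu> - d) * x = b * c * x" .
    moreover have "(\<mu> - a) * (\<mu> - d) * y = b * c * y"
    proof -
      have "(\<mu> - a) * (\<mu> - d) * y = (\<mu> - a) * ((\<mu> - d) * y)"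
        by (simp only: mult_ac)
      also have "\<dots> = c * ((\<mu> - a) * x)"
        unfolding by_cx(2)[symmetric] by (simp only: mult_ac)
      also have "\<dots> = b * c * y"
        unfolding by_cx(1)[symmetric] by (simp only: mult_ac)
      finally show ?thesis .
    qed
    ultimately show "(\<mu> - a) * (\<mu> - d) = b * c"
      using xy(1) by auto
  next
    assume char: "(\<mu> - a) * (\<mu> - d) = b * c"
    show "\<exists>x y. (x \<noteq> 0 \<or> y \<noteq> 0) \<and> a * x + b * y = \<mu> * x \<and> c * x + d * y = \<mu> * y"
    \<comment> \<open>\<open>(b, \<mu> - a)\<close> is an eigenvector unless it vanishes; in that
      case the matrix is lower triangular and the two further witnesses apply.\<close>
    proof (cases "b = 0 \<and> \<mu> = a")
      case False
      then show ?thesis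
        using char by (intro exI[of _ b] exI[of _ "\<mu> - a"]) (auto simp: algebra_simps)
    next
      case b0: True
      show ?thesis
      proof (cases "\<mu> = d")
        case True
        then show ?thesis
          using b0 by (intro exI[of _ 0] exI[of _ 1]) simp
      next
        case False
        then show ?thesis
          using b0 by (intro exI[of _ "\<mu> - d"] exI[of _ c]) (simp add: algebra_simps)
      qed
    qed
  qed
  finally show ?thesis
    by (simp add: A_def abcd)
qed

text \<open>The hypotheses say that the trace is \<open>2 * a\<close> and the determinant 1, so the
  eigenvalues are \<open>a\<close> plus or minus a square root of \<open>a\<^sup>2 - 1\<close>. For
  \<open>\<bar>a\<bar> = 1\<close> the double eigenvalue \<open>a\<close> is real of modulus 1 and
  the matrix is of neither type.\<close>

lemma unimodular_eigenvalues:
  fixes a b c :: real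
  assumes D: "fst (D (1, 0)) = a" "snd (D (0, 1)) = a" "fst (D (0, 1)) * snd (D (1, 0)) = a\<^sup>2 - 1"
  shows "(\<forall>\<mu>. eigenvalue (complex_matrix D) \<mu> \<longrightarrow> \<mu> \<notin> \<real> \<and> norm \<mu> = 1) \<longleftrightarrow> \<bar>a\<bar> < 1" (is "?E \<longleftrightarrow> _")
    and "(\<forall>\<mu>. eigenvalue (complex_matrix D) \<mu> \<longrightarrow> \<mu> \<in> \<real> \<and> norm \<mu> \<noteq> 1) \<longleftrightarrow> \<bar>a\<bar> > 1" (is "?H \<longleftrightarrow> _")
proof -
  have ev: "eigenvalue (complex_matrix D) \<mu> \<longleftrightarrow> (\<mu> - of_real a)\<^sup>2 = of_real (a\<^sup>2 - 1)" for \<mu>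
    unfolding eigenvalue_complex_matrix D power2_eq_square ..
  \<comment> \<open>Both \<open>small\<close> and \<open>large\<close> include
    \<open>\<bar>a\<bar> = 1\<close>: the first exhibits eigenvalues of modulus 1, which refute
    \<open>?H\<close>, the second real ones, which refute \<open>?E\<close>.\<close>
  have small: "eigenvalue (complex_matrix D) \<mu> \<longleftrightarrow> \<mu> = Complex a (sqrt (1 - a\<^sup>2)) \<or> \<mu> = Complex a (- sqrt (1 - a\<^sup>2))"
    if "\<bar>a\<bar> \<le> 1" for \<mu>
  proof -
    have "1 - a\<^sup>2 \<ge> 0"
      using that by (simp add: abs_square_le_1)
    then have "of_real (a\<^sup>2 - 1) = (\<i> * of_real (sqrt (1 - a\<^sup>2)))\<^sup>2"
      by (simp add: power_mult_distrib flip: of_real_power)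
    then show ?thesis
      unfolding ev by (simp only: power2_eq_iff) (auto simp: complex_eq_iff)
  qed
  have large: "eigenvalue (complex_matrix D) \<mu> \<longleftrightarrow> \<mu> = of_real (a + sqrt (a\<^sup>2 - 1)) \<or> \<mu> = of_real (a - sqrt (a\<^sup>2 - 1))"
    if "\<bar>a\<bar> \<ge> 1" for \<mu>
  proof -
    have "a\<^sup>2 - 1 \<ge> 0"
      using that abs_le_square_iff[of 1 a] by simp
    then have "complex_of_real (a\<^sup>2 - 1) = (of_real (sqrt (a\<^sup>2 - 1)))\<^sup>2"
      by (simp flip: of_real_power)
    then show ?thesis
      unfolding ev by (simp only: power2_eq_iff) (auto simp: complex_eq_iff)
  qed
  have norm_small: "norm (Complex a (sqrt (1 - a\<^sup>2))) = 1" "norm (Complex a (- sqrt (1 - a\<^sup>2))) = 1"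
    if "\<bar>a\<bar> \<le> 1"
    using that by (simp_all add: cmod_def abs_square_le_1)
  show "?E \<longleftrightarrow> \<bar>a\<bar> < 1"
  proof
    assume ?E
    then show "\<bar>a\<bar> < 1"
      using large by (metis Reals_of_real linorder_not_le)
  next
    assume "\<bar>a\<bar> < 1"
    then show ?E
      using small norm_small by (auto simp: complex_is_Real_iff abs_square_eq_1)
  qed
  show "?H \<longleftrightarrow> \<bar>a\<bar> > 1"
  proof
    assume ?H
    then show "\<bar>a\<bar> > 1"
      using small norm_small by (metis linorder_not_le)
  next
    assume a: "\<bar>a\<bar> > 1"
    \<comment> \<open>A real eigenvalue of modulus 1 is 1 or -1, and the characteristic equation
      would force \<open>a\<close> to equal it.\<close>
    have "norm \<mu> \<noteq> 1" if "eigenvalue (complex_matrix D) \<mu>" "\<mu> \<in> \<real>" for \<mu>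
    proof
      assume norm: "norm \<mu> = 1"
      obtain x where x: "\<mu> = of_real x"
        using \<open>\<mu> \<in> \<real>\<close> by (rule Reals_cases)
      have "complex_of_real ((x - a)\<^sup>2) = of_real (a\<^sup>2 - 1)"
        using that(1) unfolding ev x by simp
      then have "(x - a)\<^sup>2 = a\<^sup>2 - 1"
        by (simp only: of_real_eq_iff)
      moreover have "x = 1 \<or> x = - 1"
        using norm by (auto simp: x)
      ultimately show False
        using a by (auto simp: power2_eq_square algebra_simps)
    qed
    with a large show ?H
      by (metis Reals_of_real less_imp_le)
  qed
qed

section \<open>The second derivative test\<close>

lemma second_derivative_pos_strict_min:
  fixes f f' :: "real \<Rightarrow> real"
  assumes f: "\<And>x. (f has_real_derivative f' x) (at x)"
    and f': "f' x = 0" "(f' has_real_derivative c) (at x)" "c > 0"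
  shows "\<forall>\<^sub>F y in at x. f x < f y"
proof -
  obtain d where d: "d > 0" "\<And>h. 0 < h \<Longrightarrow> h < d \<Longrightarrow> f' x < f' (x + h)"
    using DERIV_pos_inc_right[OF f'(2,3)] by blast
  obtain e where e: "e > 0" "\<And>h. 0 < h \<Longrightarrow> h < e \<Longrightarrow> f' (x - h) < f' x"
    using DERIV_pos_inc_left[OF f'(2,3)] by blast
  have cont: "continuous_on S f" for S
    using f by (meson DERIV_isCont continuous_at_imp_continuous_on)
  \<comment> \<open>Near \<open>x\<close> the derivative is negative on the left and positive on the
    right, so \<open>f\<close> is strictly monotone on either side. The strictness later excludes a
    weak maximum at \<open>x\<close>.\<close>
  have "f x < f y" if "y \<noteq> x" "dist y x < min d e" for y
  proof (cases "x < y")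
    case True
    then show ?thesis
    proof (rule DERIV_pos_imp_increasing_open)
      fix t assume "x < t" "t < y"
      then show "\<exists>D. (f has_real_derivative D) (at t) \<and> D > 0"
        using f[of t] d(2)[of "t - x"] that f'(1) by (auto simp: dist_real_def)
    qed (rule cont)
  next
    case False
    with that have "y < x"
      by simp
    then show ?thesis
    proof (rule DERIV_neg_imp_decreasing_open)
      fix t assume "y < t" "t < x"
      then show "\<exists>D. (f has_real_derivative D) (at t) \<and> D < 0"
        using f[of t] e(2)[of "x - t"] that f'(1) by (auto simp: dist_real_def)
    qed (rule cont)
  qed
  then show ?thesis
    using d(1) e(1) by (auto simp: eventually_at intro!: exI[of _ "min d e"])
qed

lemma second_derivative_test:
  fixes f f' :: "real \<Rightarrow> real"
  assumes f: "\<And>x. (f has_real_derivative f' x) (at x)"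
    and f': "f' x = 0" "(f' has_real_derivative c) (at x)"
  shows "nondegenerate_minimum f x \<longleftrightarrow> c > 0" "nondegenerate_maximum f x \<longleftrightarrow> c < 0"
proof -
  have "deriv f = f'"
    using f DERIV_imp_deriv by blast
  then have c: "deriv (deriv f) x = c"
    using f'(2) DERIV_imp_deriv by blast
  \<comment> \<open>The punctured neighbourhood filter is nontrivial, so a strict inequality in one
    direction excludes the weak one in the other.\<close>
  have not_both: "\<not> (\<forall>\<^sub>F y in at x. P y)" if "\<forall>\<^sub>F y in at x. \<not> P y" for P
  proof
    assume "\<forall>\<^sub>F y in at x. P y"
    with that have "\<forall>\<^sub>F y in at x. False"
      by eventually_elim blast
    then show False
      by simp
  qed
  have pos: "\<forall>\<^sub>F y in at x. f x < f y" if "c > 0"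
    using second_derivative_pos_strict_min[OF f f' that] .
  have neg: "\<forall>\<^sub>F y in at x. f y < f x" if "c < 0"
    using second_derivative_pos_strict_min[of "\<lambda>x. - f x" "\<lambda>x. - f' x" x "- c"] that f f'
    by (auto intro!: derivative_intros)
  show "nondegenerate_minimum f x \<longleftrightarrow> c > 0"
    using not_both[of "\<lambda>y. f x \<le> f y"] pos neg
    unfolding nondegenerate_minimum_def c eventually_nhds_conv_at
    by (cases c "0::real" rule: linorder_cases) (auto elim: eventually_mono simp: not_le)
  show "nondegenerate_maximum f x \<longleftrightarrow> c < 0"
    using not_both[of "\<lambda>y. f y \<le> f x"] pos neg
    unfolding nondegenerate_maximum_def c eventually_nhds_conv_at
    by (cases c "0::real" rule: linorder_cases) (auto elim: eventually_mono simp: not_le)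
qed

section \<open>Curves parametrized by the tangent angle\<close>

text \<open>As the parameter is the tangent angle, the speed \<open>\<rho>\<close> is the radius of
  curvature.\<close>

locale angle_parametrized =
  fixes \<Gamma> :: "real \<Rightarrow> complex" and \<rho> :: "real \<Rightarrow> real"
  assumes deriv: "(\<Gamma> has_vector_derivative \<rho> t *\<^sub>R cis t) (at t)"
    and speed_pos: "\<rho> t > 0"
    and periodic: "\<Gamma> (t + 2 * pi) = \<Gamma> t"
begin

lemma periodic_int: "\<Gamma> (t + 2 * pi * of_int j) = \<Gamma> t"
proof -
  have nat: "\<Gamma> (t + 2 * pi * of_nat k) = \<Gamma> t" for t and k :: nat
    using periodic[of "t + 2 * pi * of_nat k" for k]
    by (induction k) (simp_all add: algebra_simps)
  show ?thesis
    using nat[of t "nat j"] nat[of "t + 2 * pi * of_int j" "nat (- j)"]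
    by (cases "j \<ge> 0") (auto simp: of_nat_nat)
qed

lemma continuous: "continuous_on S \<Gamma>"
  by (meson deriv continuous_at_imp_continuous_on has_vector_derivative_continuous)

section \<open>The signed distance of the curve from a line through one of its points\<close>

definition height :: "real \<Rightarrow> real \<Rightarrow> real \<Rightarrow> real" where
  "height \<phi> \<beta> s = inner (\<Gamma> s - \<Gamma> \<phi>) (inward_normal \<beta>)"

lemma height_self [simp]: "height \<phi> \<beta> \<phi> = 0"
  by (simp add: height_def)

lemma height_deriv: "(height \<phi> \<beta> has_real_derivative \<rho> s * sin (s - \<beta>)) (at s)"
proof -
  have "((\<lambda>s. inner (\<Gamma> s - \<Gamma> \<phi>) (inward_normal \<beta>)) has_vector_derivative
      inner (\<rho> s *\<^sub>R cis s) (inward_normal \<beta>)) (at s)"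
    using deriv[of s] unfolding has_vector_derivative_def
    by (auto intro!: derivative_eq_intros)
  then show ?thesis
    unfolding height_def has_real_derivative_iff_has_vector_derivative
    by (simp add: inner_cis_inward_normal)
qed

lemma height_isCont: "isCont (height \<phi> \<beta>) s"
  using height_deriv DERIV_isCont by blast

lemma height_increasing:
  assumes "\<beta> \<le> a" "a < b" "b \<le> \<beta> + pi"
  shows "height \<phi> \<beta> a < height \<phi> \<beta> b"
proof (rule DERIV_pos_imp_increasing_open[OF \<open>a < b\<close>])
  fix x assume "a < x" "x < b"
  with assms have "\<rho> x * sin (x - \<beta>) > 0"
    by (intro mult_pos_pos speed_pos sin_gt_zero) auto
  then show "\<exists>y. (height \<phi> \<beta> has_real_derivative y) (at x) \<and> y > 0"
    using height_deriv by blast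
qed (simp add: continuous_at_imp_continuous_on height_isCont)

lemma height_decreasing:
  assumes "\<beta> + pi \<le> a" "a < b" "b \<le> \<beta> + 2 * pi"
  shows "height \<phi> \<beta> b < height \<phi> \<beta> a"
proof (rule DERIV_neg_imp_decreasing_open[OF \<open>a < b\<close>])
  fix x assume "a < x" "x < b"
  with assms have "\<rho> x * sin (x - \<beta> - pi) > 0"
    by (intro mult_pos_pos speed_pos sin_gt_zero) auto
  moreover have "sin (x - \<beta> - pi) = - sin (x - \<beta>)"
    by (simp add: sin_diff[of "x - \<beta>" pi])
  ultimately have "\<rho> x * sin (x - \<beta>) < 0"
    by simp
  then show "\<exists>y. (height \<phi> \<beta> has_real_derivative y) (at x) \<and> y < 0"
    using height_deriv by blast
qed (simp add: continuous_at_imp_continuous_on height_isCont)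

lemma height_add_2pi: "height \<phi> \<beta> (s + 2 * pi) = height \<phi> \<beta> s"
  by (simp add: height_def periodic)

lemma height_pred_2pi: "height \<phi> (\<beta> - 2 * pi) s = height \<phi> \<beta> s"
  using inward_normal_add_2pi_int[of \<beta> "-1"] by (simp add: height_def)

lemma height_end [simp]: "height \<phi> \<beta> (\<phi> + 2 * pi) = 0"
  by (simp add: height_add_2pi)

text \<open>Strict convexity: the height over the tangent line starts at 0, increases for half a
  turn and then decreases back to 0.\<close>

lemma height_tangent_pos:
  assumes "\<phi> < s" "s < \<phi> + 2 * pi"
  shows "height \<phi> \<phi> s > 0"
proof (cases "s \<le> \<phi> + pi")
  case True
  then show ?thesis
    using height_increasing[of \<phi> \<phi> s \<phi>] assms by simp
next
  case False
  then show ?thesis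
    using height_decreasing[of \<phi> s "\<phi> + 2 * pi" \<phi>] assms by simp
qed

text \<open>The tangent line at \<open>\<phi>\<close> touches the curve in a single point. A point
  of the curve is thus determined by its normal, which \<open>rotate_eqI\<close> uses to recover
  parameters from the image of the curve.\<close>

lemma support_unique:
  assumes "inner (\<Gamma> s) (inward_normal \<phi>) \<le> inner (\<Gamma> \<phi>) (inward_normal \<phi>)"
  shows "\<Gamma> s = \<Gamma> \<phi>"
proof -
  obtain j :: int and s' where s': "s = s' + 2 * pi * j" "\<phi> \<le> s'" "s' < \<phi> + 2 * pi"
    by (rule mod_2pi)
  have eq: "\<Gamma> s = \<Gamma> s'"
    by (simp add: s' periodic_int)
  have "height \<phi> \<phi> s' \<le> 0"
    using assms by (simp add: height_def eq inner_diff_left)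
  then have "s' = \<phi>"
    using height_tangent_pos[of \<phi> s'] s' by force
  then show ?thesis
    by (simp add: eq)
qed

section \<open>The second end point of a chord\<close>

lemma height_neg_before:
  assumes "\<phi> < \<beta>" "\<beta> < \<phi> + pi" "\<phi> < s" "s \<le> \<beta>"
  shows "height \<phi> \<beta> s < 0"
  \<comment> \<open>Shifting \<open>\<beta>\<close> back by a full turn puts the interval from
    \<open>\<phi>\<close> to \<open>\<beta>\<close> into the decreasing half period that ends at
    \<open>\<beta>\<close>.\<close>
  using height_decreasing[of "\<beta> - 2 * pi" \<phi> s \<phi>] assms by (simp add: height_pred_2pi)

lemma height_pos_after:
  assumes "\<phi> < \<beta>" "\<beta> < \<phi> + pi" "\<beta> + pi \<le> s" "s < \<phi> + 2 * pi"
  shows "height \<phi> \<beta> s > 0"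
  using height_decreasing[of \<beta> s "\<phi> + 2 * pi" \<phi>] assms by simp

text \<open>The height is negative at \<open>\<beta>\<close> and positive at
  \<open>\<beta> + pi\<close>, so the intermediate value theorem gives a zero. Uniqueness follows
  below from the signs outside this interval and strict growth inside it.\<close>

lemma chord_end_exists:
  assumes "\<phi> < \<beta>" "\<beta> < \<phi> + pi"
  shows "\<exists>s. \<phi> < s \<and> s < \<phi> + 2 * pi \<and> height \<phi> \<beta> s = 0"
proof -
  have "height \<phi> \<beta> \<beta> < 0" "height \<phi> \<beta> (\<beta> + pi) > 0"
    using height_neg_before[OF assms, of \<beta>] height_pos_after[OF assms, of "\<beta> + pi"] assms by auto
  then obtain s where "\<beta> \<le> s" "s \<le> \<beta> + pi" "height \<phi> \<beta> s = 0"
    using IVT[of "height \<phi> \<beta>" \<beta> 0 "\<beta> + pi"] height_isCont by auto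
  with assms show ?thesis
    by (intro exI[of _ s]) auto
qed

lemma chord_end_range:
  assumes "\<phi> < \<beta>" "\<beta> < \<phi> + pi" "\<phi> < s" "s < \<phi> + 2 * pi" "height \<phi> \<beta> s = 0"
  shows "\<beta> < s" "s < \<beta> + pi"
  using height_neg_before[OF assms(1-3)] height_pos_after[OF assms(1,2) _ assms(4)] assms(5)
  by force+

lemma chord_end_unique:
  assumes "\<phi> < \<beta>" "\<beta> < \<phi> + pi"
    and "\<phi> < s" "s < \<phi> + 2 * pi" "height \<phi> \<beta> s = 0"
    and "\<phi> < t" "t < \<phi> + 2 * pi" "height \<phi> \<beta> t = 0"
  shows "s = t"
  using chord_end_range[OF assms(1-5)] chord_end_range[OF assms(1,2) assms(6-8)]
    height_increasing[of \<beta> s t \<phi>] height_increasing[of \<beta> t s \<phi>] assms(5,8)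
  by (cases s t rule: linorder_cases) auto

text \<open>Taking the parameter in the turn that follows \<open>\<phi>\<close> fixes a real
  representative of the next impact.\<close>

definition next_angle :: "real \<Rightarrow> real \<Rightarrow> real" where
  "next_angle \<phi> p = (THE s. \<phi> < s \<and> s < \<phi> + 2 * pi \<and> height \<phi> (\<phi> + arccos p) s = 0)"

lemma arccos_range:
  assumes "\<bar>p\<bar> < 1"
  shows "\<phi> < \<phi> + arccos p" "\<phi> + arccos p < \<phi> + pi"
  using arccos_lt_bounded[of p] assms by auto

lemma next_angle_eqI:
  assumes "\<bar>p\<bar> < 1" "\<phi> < s" "s < \<phi> + 2 * pi" "height \<phi> (\<phi> + arccos p) s = 0"
  shows "next_angle \<phi> p = s"
  unfolding next_angle_def using chord_end_unique[OF arccos_range[OF assms(1)]] assms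
  by (intro the_equality) blast+

lemma next_angle:
  assumes "\<bar>p\<bar> < 1"
  shows "\<phi> < next_angle \<phi> p" "next_angle \<phi> p < \<phi> + 2 * pi"
    "height \<phi> (\<phi> + arccos p) (next_angle \<phi> p) = 0"
  using chord_end_exists[OF arccos_range[OF assms], of \<phi>] next_angle_eqI[OF assms] by metis+

text \<open>Zero height makes the chord parallel to \<open>v\<close>; it points forward because its
  end and \<open>v\<close> are on the same side of the tangent at \<open>\<phi>\<close>.\<close>

lemma chord_direction:
  fixes p \<phi> :: real
  assumes "\<bar>p\<bar> < 1"
  defines "v \<equiv> cis (\<phi> + arccos p)" and "s \<equiv> next_angle \<phi> p"
  obtains t where "t > 0" "\<Gamma> s - \<Gamma> \<phi> = t *\<^sub>R v"
proof
  define t where "t = inner (\<Gamma> s - \<Gamma> \<phi>) v"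
  show eq: "\<Gamma> s - \<Gamma> \<phi> = t *\<^sub>R v"
    using orthonormal_decomposition[of "\<Gamma> s - \<Gamma> \<phi>" "\<phi> + arccos p"] next_angle(3)[OF assms(1), of \<phi>]
    by (simp add: t_def v_def s_def height_def)
  have "height \<phi> \<phi> s > 0"
    using height_tangent_pos next_angle[OF assms(1)] by (simp add: s_def)
  then have "t * sin (arccos p) > 0"
    by (simp add: height_def eq v_def inner_cis_inward_normal)
  moreover have "sin (arccos p) > 0"
    using arccos_range[OF assms(1), of 0] by (simp add: sin_gt_zero)
  ultimately show "t > 0"
    by (simp add: zero_less_mult_iff)
qed

text \<open>Reduced to the turn after \<open>\<phi>\<close>, the parameter \<open>s\<close> is a
  zero of the height; \<open>t \<noteq> 0\<close> rules out the starting point, and the remaining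
  zero is unique.\<close>

lemma hit_eq_next_angle:
  fixes p \<phi> :: real
  assumes "\<bar>p\<bar> < 1" "t \<noteq> 0" "\<Gamma> s = \<Gamma> \<phi> + t *\<^sub>R cis (\<phi> + arccos p)"
  obtains j :: int where "s = next_angle \<phi> p + 2 * pi * j"
proof -
  obtain j :: int and s' where s': "s = s' + 2 * pi * j" "\<phi> \<le> s'" "s' < \<phi> + 2 * pi"
    by (rule mod_2pi)
  have eq: "\<Gamma> s = \<Gamma> s'"
    by (simp add: s' periodic_int)
  have "s' \<noteq> \<phi>"
    using assms by (auto simp: eq)
  moreover have "height \<phi> (\<phi> + arccos p) s' = 0"
    using assms(3) by (simp add: height_def eq inner_cis_inward_normal)
  ultimately have "next_angle \<phi> p = s'"
    using s' assms(1) by (intro next_angle_eqI) auto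
  then show ?thesis
    using s' that by blast
qed

section \<open>Collisions and the billiard map\<close>

lemma next_collision_next_angle:
  fixes p \<phi> :: real
  assumes "\<bar>p\<bar> < 1"
  defines "s \<equiv> next_angle \<phi> p"
  shows "next_collision \<Gamma> (\<phi>, p) (s, cos (s - (\<phi> + arccos p)))"
proof -
  define \<beta> where "\<beta> = \<phi> + arccos p"
  obtain t where t: "t > 0" "\<Gamma> s - \<Gamma> \<phi> = t *\<^sub>R cis \<beta>"
    unfolding s_def \<beta>_def by (rule chord_direction[OF assms(1)])
  have range: "0 < s - \<beta>" "s - \<beta> < pi"
    using chord_end_range[OF arccos_range[OF assms(1)] next_angle[OF assms(1)], of \<phi>]
    by (simp_all add: s_def \<beta>_def)
  have "\<Gamma> \<phi> + u *\<^sub>R cis \<beta> \<notin> range \<Gamma>" if "u \<in> {0<..<t}" for u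
  proof
    \<comment> \<open>An earlier hit would have the parameter \<open>s\<close> modulo
      \<open>2 * pi\<close>, hence be the same point, forcing \<open>u = t\<close>.\<close>
    assume "\<Gamma> \<phi> + u *\<^sub>R cis \<beta> \<in> range \<Gamma>"
    then obtain s' where s': "\<Gamma> s' = \<Gamma> \<phi> + u *\<^sub>R cis \<beta>"
      by (metis rangeE)
    with that obtain j :: int where "s' = s + 2 * pi * j"
      using hit_eq_next_angle[OF assms(1), of u s' \<phi>] by (auto simp: s_def \<beta>_def)
    then have "\<Gamma> s' = \<Gamma> s"
      by (simp add: periodic_int)
    with s' t have "t *\<^sub>R cis \<beta> = u *\<^sub>R cis \<beta>"
      by (metis add_diff_cancel_left')
    with that show False
      by simp
  qed
  \<comment> \<open>The chord of direction \<open>\<beta>\<close> leaves with direction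
    \<open>2 * s - \<beta>\<close>, so the new angle to the tangent is \<open>s - \<beta>\<close>;
    it lies between 0 and \<open>pi\<close>, where \<open>arccos\<close> inverts
    \<open>cos\<close>.\<close>
  moreover have "arccos (cos (s - \<beta>)) = s - \<beta>"
    using range by (simp add: arccos_cos)
  moreover have "cos (s - \<beta>) \<in> {-1<..<1}"
    using range cos_monotone_0_pi[of 0 "s - \<beta>"] cos_monotone_0_pi[of "s - \<beta>" pi] by auto
  moreover have "\<Gamma> s = \<Gamma> \<phi> + t *\<^sub>R cis \<beta>"
    using t(2) by (simp add: algebra_simps)
  moreover have "s + (s - \<beta>) = 2 * s - \<beta>"
    by simp
  ultimately show ?thesis
    using assms(1) t(1) unfolding next_collision_def Let_def prod.case \<beta>_def[symmetric]
    by (auto simp: cis_reflect)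
qed

lemma next_collision_unique:
  fixes p \<phi> :: real
  assumes "\<bar>p\<bar> < 1" "cis \<phi>\<^sub>1 = cis \<phi>" "next_collision \<Gamma> (\<phi>\<^sub>1, p) (\<phi>', p')"
  defines "s \<equiv> next_angle \<phi> p"
  shows "cis \<phi>' = cis s" "p' = cos (s - (\<phi> + arccos p))"
proof -
  define \<beta> where "\<beta> = \<phi> + arccos p"
  obtain i :: int where i: "\<phi>\<^sub>1 = \<phi> + 2 * pi * i"
    using assms(2) by (rule cis_eqE)
  have "\<Gamma> \<phi>\<^sub>1 = \<Gamma> \<phi>"
    by (simp add: i periodic_int)
  moreover have \<beta>: "cis (\<phi>\<^sub>1 + arccos p) = cis \<beta>"
    using cis_add_2pi_int[of \<beta> i] by (simp add: i \<beta>_def algebra_simps)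
  moreover have "cis (2 * \<phi>' - (\<phi>\<^sub>1 + arccos p)) = cis (2 * \<phi>' - \<beta>)"
    by (simp only: \<beta> flip: cis_divide)
  ultimately obtain t where t: "t > 0" "\<Gamma> \<phi>' = \<Gamma> \<phi> + t *\<^sub>R cis \<beta>"
    and p': "\<bar>p'\<bar> < 1" "cis (\<phi>' + arccos p') = cis (2 * \<phi>' - \<beta>)"
    using assms(3) by (auto simp: next_collision_def Let_def cis_reflect)
  from t obtain j :: int where j: "\<phi>' = s + 2 * pi * j"
    using hit_eq_next_angle[OF assms(1), of t \<phi>' \<phi>] by (auto simp: s_def \<beta>_def)
  show "cis \<phi>' = cis s"
    by (simp add: j cis_add_2pi_int)
  have "cis (arccos p') = cis (\<phi>' + arccos p') * cis (- \<phi>')"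
    by (simp add: cis_mult)
  also have "\<dots> = cis (\<phi>' - \<beta>)"
    by (simp add: p' cis_mult algebra_simps)
  also have "\<dots> = cis (s - \<beta>)"
    using cis_add_2pi_int[of "s - \<beta>" j] by (simp add: j algebra_simps)
  finally have "cos (arccos p') = cos (s - \<beta>)"
    by (simp add: complex_eq_iff)
  with p' show "p' = cos (s - (\<phi> + arccos p))"
    by (simp add: cos_arccos_abs \<beta>_def)
qed

lemma billiard_map_eq:
  fixes p \<phi> :: real
  assumes "\<bar>p\<bar> < 1"
  defines "s \<equiv> next_angle \<phi> p"
  shows "billiard_map \<Gamma> (phase_of (\<phi>, p)) = phase_of (s, cos (s - (\<phi> + arccos p)))"
  unfolding billiard_map_def
proof (rule the_equality)
  show "\<exists>x x'. phase_of (\<phi>, p) = phase_of x \<and>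
      phase_of (s, cos (s - (\<phi> + arccos p))) = phase_of x' \<and> next_collision \<Gamma> x x'"
    using next_collision_next_angle[OF assms(1)] unfolding s_def by blast
next
  fix z'
  assume "\<exists>x x'. phase_of (\<phi>, p) = phase_of x \<and> z' = phase_of x' \<and> next_collision \<Gamma> x x'"
  then obtain \<phi>\<^sub>1 \<phi>' p' where z': "cis \<phi>\<^sub>1 = cis \<phi>" "z' = phase_of (\<phi>', p')"
    and hit: "next_collision \<Gamma> (\<phi>\<^sub>1, p) (\<phi>', p')"
    by (auto simp: phase_of_def)
  show "z' = phase_of (s, cos (s - (\<phi> + arccos p)))"
    unfolding z' using next_collision_unique[OF assms(1) z'(1) hit] unfolding s_def by (simp add: phase_of_def)
qed

section \<open>Derivatives of the support function\<close>

lemma support_fun_deriv: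
  "(support_fun \<Gamma> has_real_derivative inner (\<Gamma> t) (cis t)) (at t)"
proof -
  have "((\<lambda>t. - inner (\<Gamma> t) (\<i> * cis t)) has_derivative (*) (inner (\<Gamma> t) (cis t))) (at t)"
    using deriv[of t] unfolding has_vector_derivative_def
    by (rule has_derivative_eq_rhs[OF has_derivative_minus[OF has_derivative_inner[OF _
            has_derivative_mult_right[OF has_derivative_cis[OF has_derivative_ident]]]]])
       (simp add: fun_eq_iff inner_complex_def algebra_simps)
  then show ?thesis
    by (simp add: support_fun_def[abs_def] inward_normal_eq has_field_derivative_def)
qed

lemma support_fun_deriv2:
  "((\<lambda>t. inner (\<Gamma> t) (cis t)) has_real_derivative \<rho> t - support_fun \<Gamma> t) (at t)"
  using deriv[of t] unfolding has_vector_derivative_def has_field_derivative_def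
  by (rule has_derivative_eq_rhs[OF has_derivative_inner[OF _ has_derivative_cis[OF has_derivative_ident]]])
     (simp add: fun_eq_iff inner_cis_cis support_fun_def inward_normal_eq algebra_simps)

text \<open>The converse of shooting from \<open>\<phi>\<close>: a chord is recovered from its
  starting cosine. This makes the pair of end points a coordinate system on phase space.\<close>

lemma next_angle_chord:
  assumes "\<phi> < s" "s < \<phi> + 2 * pi"
  defines "p \<equiv> inner (\<Gamma> s - \<Gamma> \<phi>) (cis \<phi>) / norm (\<Gamma> s - \<Gamma> \<phi>)"
  shows "\<Gamma> s - \<Gamma> \<phi> \<noteq> 0" "\<bar>p\<bar> < 1" "next_angle \<phi> p = s"
proof -
  \<comment> \<open>After rotation by \<open>- \<phi>\<close> the imaginary part of the chord is its
    height over the tangent, so its argument is the outgoing angle.\<close>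
  define z where "z = cis (- \<phi>) * (\<Gamma> s - \<Gamma> \<phi>)"
  define a where "a = Arg z"
  have "Im z = height \<phi> \<phi> s"
    by (simp add: z_def height_def inner_complex_def inward_normal_def algebra_simps)
  then have "Im z > 0"
    using height_tangent_pos assms(1,2) by simp
  then have a: "0 < a" "a < pi"
    using Arg_lt_pi[of z] by (auto simp: a_def)
  have chord: "\<Gamma> s - \<Gamma> \<phi> = cis \<phi> * z"
    by (simp add: z_def cis_mult flip: mult.assoc)
  also have "\<dots> = norm z *\<^sub>R cis (\<phi> + a)"
    using rcis_cmod_Arg[of z]
    by (simp add: a_def rcis_def scaleR_conv_of_real mult.left_commute flip: cis_mult)
  finally have C: "\<Gamma> s - \<Gamma> \<phi> = norm z *\<^sub>R cis (\<phi> + a)" .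
  have "z \<noteq> 0"
    using \<open>Im z > 0\<close> by auto
  then show "\<Gamma> s - \<Gamma> \<phi> \<noteq> 0"
    by (simp add: chord)
  have p: "p = cos a"
    using \<open>z \<noteq> 0\<close> by (simp add: p_def C inner_cis_cis)
  show "\<bar>p\<bar> < 1"
    using a cos_monotone_0_pi[of 0 a] cos_monotone_0_pi[of a pi] by (auto simp: p)
  moreover have "arccos p = a"
    using a by (simp add: p arccos_cos)
  then have "height \<phi> (\<phi> + arccos p) s = 0"
    by (simp add: height_def C inner_cis_inward_normal)
  ultimately show "next_angle \<phi> p = s"
    using next_angle_eqI assms(1,2) by blast
qed

section \<open>The billiard map on the universal cover and its derivative\<close>

definition lift :: "real \<times> real \<Rightarrow> real \<times> real" where
  "lift y = (let s = next_angle (fst y) (snd y) in (s, cos (s - (fst y + arccos (snd y)))))"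

lemma billiard_map_lift:
  assumes "\<bar>snd y\<bar> < 1"
  shows "billiard_map \<Gamma> (phase_of y) = phase_of (lift y)"
  using billiard_map_eq[OF assms, of "fst y"] by (simp add: lift_def Let_def)

text \<open>Expresses the new cosine by the end points of the chord alone, as the map
  \<open>K\<close> below requires.\<close>

lemma cos_outgoing:
  fixes p \<phi> :: real
  assumes "\<bar>p\<bar> < 1"
  defines "s \<equiv> next_angle \<phi> p"
  shows "cos (s - (\<phi> + arccos p)) = inner (\<Gamma> s - \<Gamma> \<phi>) (cis s) / norm (\<Gamma> s - \<Gamma> \<phi>)"
proof -
  obtain t where "t > 0" "\<Gamma> s - \<Gamma> \<phi> = t *\<^sub>R cis (\<phi> + arccos p)"
    unfolding s_def by (rule chord_direction[OF assms(1)])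
  then have "inner (\<Gamma> s - \<Gamma> \<phi>) (cis s) / norm (\<Gamma> s - \<Gamma> \<phi>) = cos (\<phi> + arccos p - s)"
    by (simp add: inner_cis_cis)
  then show ?thesis
    by (metis cos_minus minus_diff_eq)
qed

text \<open>
  In the coordinates given by the two end points of a chord, both the incoming and the outgoing
  cosine are explicit. The billiard map is the second of these maps after the inverse of the first.
\<close>

lemma lift_derivative:
  fixes \<phi> \<alpha> g :: real
  assumes \<alpha>: "0 < \<alpha>" "\<alpha> < pi" and g: "g > 0"
    and start: "\<Gamma> \<phi> = - (g *\<^sub>R inward_normal \<phi>)"
    and stop: "\<Gamma> (\<phi> + 2 * \<alpha>) = - (g *\<^sub>R inward_normal (\<phi> + 2 * \<alpha>))"
    and speed: "\<rho> (\<phi> + 2 * \<alpha>) = \<rho> \<phi>"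
  defines "r \<equiv> \<rho> \<phi> / (2 * g)"
  shows "lift (\<phi>, cos \<alpha>) = (\<phi> + 2 * \<alpha>, cos \<alpha>)"
    and "(lift has_derivative (\<lambda>h. let b = ((1 - r) * fst h - snd h / sin \<alpha>) / r
      in (b, - sin \<alpha> * ((1 - r) * b - r * fst h)))) (at (\<phi>, cos \<alpha>))"
proof -
  define s where "s = \<phi> + 2 * \<alpha>"
  define l where "l = 2 * g * sin \<alpha>"
  define C where "C = (\<lambda>y. \<Gamma> (snd y) - \<Gamma> (fst y))"
  have sin_pos: "sin \<alpha> > 0"
    using \<alpha> by (simp add: sin_gt_zero)
  then have "l > 0" "r > 0"
    using g speed_pos by (simp_all add: l_def r_def)
  \<comment> \<open>Both ends have the form \<open>- g\<close> times the normal, so the chord is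
    \<open>g\<close> times a difference of normals; its direction is the mean angle
    \<open>\<phi> + \<alpha>\<close>.\<close>
  have "inward_normal (c - \<alpha>) - inward_normal (c + \<alpha>) = (2 * sin \<alpha>) *\<^sub>R cis c" for c
    by (simp add: inward_normal_def complex_eq_iff sin_add cos_add sin_diff cos_diff)
  from this[of "\<phi> + \<alpha>"]
  have "inward_normal \<phi> - inward_normal (\<phi> + 2 * \<alpha>) = (2 * sin \<alpha>) *\<^sub>R cis (\<phi> + \<alpha>)"
    by (simp add: add.assoc)
  moreover have "\<Gamma> s - \<Gamma> \<phi> = g *\<^sub>R (inward_normal \<phi> - inward_normal (\<phi> + 2 * \<alpha>))"
    by (simp add: s_def start stop scaleR_diff_right)
  ultimately have chord: "\<Gamma> s - \<Gamma> \<phi> = l *\<^sub>R cis (\<phi> + \<alpha>)"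
    by (simp add: l_def mult.assoc)
  have cos_less: "\<bar>cos \<alpha>\<bar> < 1"
    using \<alpha> cos_monotone_0_pi[of 0 \<alpha>] cos_monotone_0_pi[of \<alpha> pi] by auto
  have arccos: "arccos (cos \<alpha>) = \<alpha>"
    using \<alpha> by (simp add: arccos_cos)
  have next_eq: "next_angle \<phi> (cos \<alpha>) = s"
    using \<alpha> by (intro next_angle_eqI[OF cos_less])
      (auto simp: s_def arccos height_def chord[unfolded s_def] inner_cis_inward_normal)
  show "lift (\<phi>, cos \<alpha>) = (\<phi> + 2 * \<alpha>, cos \<alpha>)"
    by (simp add: lift_def next_eq arccos s_def)
  define C' where "C' = (\<lambda>h. (snd h * \<rho> s) *\<^sub>R cis s - (fst h * \<rho> \<phi>) *\<^sub>R cis \<phi>)"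
  have \<Gamma>_deriv: "(\<Gamma> has_derivative (\<lambda>h. (h * \<rho> t) *\<^sub>R cis t)) (at t)" for t
    using deriv[of t] by (simp add: has_vector_derivative_def)
  have C: "(C has_derivative C') (at (\<phi>, s))"
    unfolding C_def C'_def
    by (intro has_derivative_diff has_derivative_compose[OF has_derivative_snd[OF has_derivative_ident]]
        has_derivative_compose[OF has_derivative_fst[OF has_derivative_ident]])
       (simp_all add: \<Gamma>_deriv)
  have C_base: "C (\<phi>, s) = l *\<^sub>R cis (\<phi> + \<alpha>)"
    by (simp add: C_def chord)
  define H where "H = (\<lambda>y. (fst y, inner (C y) (cis (fst y)) / norm (C y)))"
  define K where "K = (\<lambda>y. (snd y, inner (C y) (cis (snd y)) / norm (C y)))"
  define H' where "H' = (\<lambda>h::real \<times> real. (fst h, - sin \<alpha> * (r * snd h + (r - 1) * fst h)))"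
  define K' where "K' = (\<lambda>h::real \<times> real. (snd h, - sin \<alpha> * ((1 - r) * snd h - r * fst h)))"
  have [simp]: "\<rho> s = \<rho> \<phi>"
    by (simp add: s_def speed)
  have \<rho>_eq: "\<rho> \<phi> = 2 * g * r"
    using g by (simp add: r_def)
  have C'_eq: "C' h = (2 * g * r * snd h) *\<^sub>R cis (\<phi> + 2 * \<alpha>) - (2 * g * r * fst h) *\<^sub>R cis \<phi>" for h
    unfolding C'_def \<open>\<rho> s = \<rho> \<phi>\<close> \<rho>_eq by (simp add: s_def mult.commute)
  have i1: "inner (C' h) (cis \<phi>) = 2 * g * r * (snd h * cos (2 * \<alpha>) - fst h)"
    and i2: "inner (C' h) (cis (\<phi> + 2 * \<alpha>)) = 2 * g * r * (snd h - fst h * cos (2 * \<alpha>))"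
    and i3: "inner (C' h) (cis (\<phi> + \<alpha>)) = 2 * g * r * cos \<alpha> * (snd h - fst h)" for h
    by (simp_all add: C'_eq inner_diff_left inner_cis_cis algebra_simps)
  \<comment> \<open>One trigonometric reduction serves both ends. At \<open>s\<close> it is applied
    to the negated inner products with the roles of \<open>fst h\<close> and \<open>snd h\<close>
    exchanged.\<close>
  have chord_identity: "C\<^sub>1 = 2 * g * r * (u * cos (2 * \<alpha>) - v) \<Longrightarrow>
      C\<^sub>2 = 2 * g * r * cos \<alpha> * (u - v) \<Longrightarrow> (C\<^sub>1 - cos \<alpha> * C\<^sub>2) / l = - r * sin \<alpha> * (u + v)"
    for C\<^sub>1 C\<^sub>2 u v
  proof -
    assume eqs: "C\<^sub>1 = 2 * g * r * (u * cos (2 * \<alpha>) - v)" "C\<^sub>2 = 2 * g * r * cos \<alpha> * (u - v)"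
    have "C\<^sub>1 - cos \<alpha> * C\<^sub>2 = 2 * g * r * (u * cos (2 * \<alpha>) - v - (cos \<alpha>)\<^sup>2 * (u - v))"
      unfolding eqs by (simp add: algebra_simps power2_eq_square)
    also have "\<dots> = l * (- r * sin \<alpha> * (u + v))"
      unfolding cos_double cos_squared_eq l_def by (simp add: algebra_simps power2_eq_square)
    finally show ?thesis
      using \<open>l > 0\<close> by simp
  qed
  have H'_eq: "(inner (C' h) (cis \<phi>) - cos \<alpha> * inner (C' h) (cis (\<phi> + \<alpha>))) / l + sin \<alpha> * fst h
      = - sin \<alpha> * (r * snd h + (r - 1) * fst h)" for h
    by (subst chord_identity[OF i1 i3]) (simp add: algebra_simps)
  have K'_eq: "(inner (C' h) (cis s) - cos \<alpha> * inner (C' h) (cis (\<phi> + \<alpha>))) / l - sin \<alpha> * snd h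
      = - sin \<alpha> * ((1 - r) * snd h - r * fst h)" for h
  proof -
    have "(- inner (C' h) (cis s) - cos \<alpha> * - inner (C' h) (cis (\<phi> + \<alpha>))) / l
        = - r * sin \<alpha> * (fst h + snd h)"
      by (rule chord_identity) (simp_all add: s_def i2 i3 right_diff_distrib)
    moreover have "- inner (C' h) (cis s) - cos \<alpha> * - inner (C' h) (cis (\<phi> + \<alpha>))
        = - (inner (C' h) (cis s) - cos \<alpha> * inner (C' h) (cis (\<phi> + \<alpha>)))"
      by simp
    ultimately have "(inner (C' h) (cis s) - cos \<alpha> * inner (C' h) (cis (\<phi> + \<alpha>))) / l
        = r * sin \<alpha> * (fst h + snd h)"
      by (simp only: minus_divide_left[symmetric] mult_minus_left neg_equal_iff_equal)
    then show ?thesis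
      by (simp add: algebra_simps)
  qed
  have H: "(H has_derivative H') (at (\<phi>, s))"
    unfolding H_def
    by (rule has_derivative_eq_rhs, rule has_derivative_Pair[OF has_derivative_fst[OF has_derivative_ident]
          direction_cos_derivative[OF C has_derivative_fst[OF has_derivative_ident] C_base \<open>l > 0\<close>]])
       (simp add: H'_def fun_eq_iff H'_eq)
  have K: "(K has_derivative K') (at (\<phi>, s))"
    unfolding K_def
    by (rule has_derivative_eq_rhs, rule has_derivative_Pair[OF has_derivative_snd[OF has_derivative_ident]
          direction_cos_derivative[OF C has_derivative_snd[OF has_derivative_ident] C_base \<open>l > 0\<close>]])
       (simp add: K'_def fun_eq_iff s_def K'_eq[unfolded s_def])
  define G where "G = (\<lambda>y. (fst y, next_angle (fst y) (snd y)))"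
  define S where "S = {y::real \<times> real. fst y < snd y \<and> snd y < fst y + 2 * pi}"
  define G' where "G' = (\<lambda>h::real \<times> real. (fst h, ((1 - r) * fst h - snd h / sin \<alpha>) / r))"
  have "open S"
    unfolding S_def by (intro open_Collect_conj open_Collect_less continuous_intros)
  have "(\<phi>, s) \<in> S"
    using \<alpha> by (simp add: S_def s_def)
  have "continuous_on S H"
    unfolding H_def C_def
    by (intro continuous_intros continuous_on_compose2[OF continuous])
       (use next_angle_chord(1) in \<open>auto simp: S_def\<close>)
  have GH: "G (H y) = y" if "y \<in> S" for y
    using that next_angle_chord(3) by (simp add: G_def H_def C_def S_def)
  have H_base: "H (\<phi>, s) = (\<phi>, cos \<alpha>)"
    using \<open>l > 0\<close> by (simp add: H_def C_base inner_cis_cis)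
  \<comment> \<open>Inverse function theorem: \<open>G\<close> is a left inverse of the continuous
    \<open>H\<close> on the open set \<open>S\<close>, so it remains to check that \<open>G'\<close>
    is a right inverse of \<open>H'\<close>.\<close>
  have "(G has_derivative G') (at (H (\<phi>, s)))"
    using \<open>open S\<close> \<open>(\<phi>, s) \<in> S\<close> \<open>continuous_on S H\<close> GH H
  proof (rule has_derivative_inverse_strong)
    show "H' \<circ> G' = id"
      using sin_pos \<open>r > 0\<close> by (simp add: H'_def G'_def fun_eq_iff field_simps)
  qed
  then have "(G has_derivative G') (at (\<phi>, cos \<alpha>))"
    by (simp add: H_base)
  moreover have "(K has_derivative K') (at (G (\<phi>, cos \<alpha>)))"
    using K by (simp add: G_def next_eq)
  ultimately have "((\<lambda>y. K (G y)) has_derivative (\<lambda>h. K' (G' h))) (at (\<phi>, cos \<alpha>))"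
    by (rule has_derivative_compose)
  then have "(lift has_derivative (\<lambda>h. K' (G' h))) (at (\<phi>, cos \<alpha>))"
  proof (rule has_derivative_transform_within_open)
    show "open {y::real \<times> real. \<bar>snd y\<bar> < 1}"
      by (intro open_Collect_less continuous_intros)
    show "K (G y) = lift y" if "y \<in> {y. \<bar>snd y\<bar> < 1}" for y
      using that cos_outgoing[of "snd y" "fst y"] by (simp add: K_def G_def C_def lift_def Let_def)
  qed (simp add: cos_less)
  then show "(lift has_derivative (\<lambda>h. let b = ((1 - r) * fst h - snd h / sin \<alpha>) / r
      in (b, - sin \<alpha> * ((1 - r) * b - r * fst h)))) (at (\<phi>, cos \<alpha>))"
    by (simp add: K'_def G'_def Let_def)
qed

section \<open>Rotational symmetry\<close>

text \<open>On the curve, \<open>\<Gamma> \<phi>\<close> minimises the inner product with the normal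
  at \<open>\<phi>\<close>. Rotation by \<open>\<delta>\<close> carries this minimiser to the one
  for the normal at \<open>\<phi> + \<delta>\<close>, which is unique.\<close>

lemma rotate_eqI:
  assumes "(\<lambda>z. cis \<delta> * z) ` range \<Gamma> = range \<Gamma>"
  shows "\<Gamma> (\<phi> + \<delta>) = cis \<delta> * \<Gamma> \<phi>"
proof -
  obtain \<psi> where \<psi>: "cis \<delta> * \<Gamma> \<phi> = \<Gamma> \<psi>"
    using assms by (metis imageI rangeE rangeI)
  \<comment> \<open>Rotating \<open>\<Gamma> (\<phi> + \<delta>)\<close> back to the curve allows
    its comparison with the minimiser at \<open>\<phi>\<close>.\<close>
  have "\<Gamma> (\<phi> + \<delta>) \<in> (\<lambda>z. cis \<delta> * z) ` range \<Gamma>"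
    unfolding assms by simp
  then obtain \<psi>' where \<psi>': "\<Gamma> (\<phi> + \<delta>) = cis \<delta> * \<Gamma> \<psi>'"
    by auto
  have min: "inner (\<Gamma> \<phi>) (inward_normal \<phi>) \<le> inner (\<Gamma> \<psi>') (inward_normal \<phi>)"
    using support_unique[of \<psi>' \<phi>] by force
  have "inner (\<Gamma> \<psi>) (inward_normal (\<phi> + \<delta>)) = inner (\<Gamma> \<phi>) (inward_normal \<phi>)"
    by (simp add: inward_normal_add inner_rotate flip: \<psi>)
  also note min
  also have "inner (\<Gamma> \<psi>') (inward_normal \<phi>) = inner (\<Gamma> (\<phi> + \<delta>)) (inward_normal (\<phi> + \<delta>))"
    by (simp add: inward_normal_add inner_rotate \<psi>')
  finally show ?thesis
    using support_unique[of \<psi> "\<phi> + \<delta>"] \<psi> by simp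
qed

context
  fixes \<delta> :: real
  assumes rotate: "\<And>t. \<Gamma> (t + \<delta>) = cis \<delta> * \<Gamma> t"
begin

text \<open>Every integer multiple of \<open>\<delta>\<close> again satisfies the assumption of this
  context, so its other lemmas can be applied to multiples.\<close>

lemma rotate_int: "\<Gamma> (t + \<delta> * of_int j) = cis (\<delta> * of_int j) * \<Gamma> t"
proof -
  have nat: "\<Gamma> (t + \<delta> * of_nat k) = cis (\<delta> * of_nat k) * \<Gamma> t" for t k
  proof (induction k)
    case (Suc k)
    have "\<Gamma> (t + \<delta> * of_nat (Suc k)) = \<Gamma> (t + \<delta> * of_nat k + \<delta>)"
      by (simp add: algebra_simps)
    also have "\<dots> = cis (\<delta> * of_nat (Suc k)) * \<Gamma> t"
      by (simp add: rotate Suc cis_mult mult.assoc[symmetric] distrib_left)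
    finally show ?case .
  qed simp
  show ?thesis
  proof (cases "j \<ge> 0")
    case True
    then show ?thesis
      using nat[of t "nat j"] by simp
  next
    case False
    then have "\<Gamma> t = cis (- (\<delta> * of_int j)) * \<Gamma> (t + \<delta> * of_int j)"
      using nat[of "t + \<delta> * of_int j" "nat (- j)"] by simp
    then show ?thesis
      by (simp add: cis_mult mult.assoc[symmetric])
  qed
qed

lemma speed_rotate: "\<rho> (t + \<delta>) = \<rho> t"
proof -
  have "((\<lambda>t. \<Gamma> (t + \<delta>)) has_vector_derivative \<rho> (t + \<delta>) *\<^sub>R cis (t + \<delta>)) (at t)"
  proof -
    have "((\<lambda>t. t + \<delta>) has_vector_derivative 1) (at t)"
      by (auto simp: has_vector_derivative_def intro!: derivative_eq_intros)
    from vector_diff_chain_at[OF this deriv] show ?thesis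
      by (simp add: o_def)
  qed
  moreover have "((\<lambda>t. cis \<delta> * \<Gamma> t) has_vector_derivative cis \<delta> * (\<rho> t *\<^sub>R cis t)) (at t)"
    by (intro has_vector_derivative_mult_right deriv)
  ultimately have "\<rho> (t + \<delta>) *\<^sub>R cis (t + \<delta>) = cis \<delta> * (\<rho> t *\<^sub>R cis t)"
    unfolding rotate by (rule vector_derivative_unique_at)
  also have "\<dots> = \<rho> t *\<^sub>R cis (t + \<delta>)"
    by (simp add: cis_mult add.commute)
  finally show ?thesis
    by simp
qed

lemma support_fun_rotate: "support_fun \<Gamma> (t + \<delta>) = support_fun \<Gamma> t"
  by (simp add: support_fun_def rotate inward_normal_add inner_rotate)

lemma inner_tangent_rotate: "inner (\<Gamma> (t + \<delta>)) (cis (t + \<delta>)) = inner (\<Gamma> t) (cis t)"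
  by (metis rotate inner_rotate cis_mult add.commute)

lemma height_rotate: "height (\<phi> + \<delta>) (\<beta> + \<delta>) (s + \<delta>) = height \<phi> \<beta> s"
  by (simp add: height_def rotate inward_normal_add inner_rotate flip: right_diff_distrib)

lemma lift_rotate:
  assumes "\<bar>p\<bar> < 1"
  shows "lift (\<phi> + \<delta>, p) = (fst (lift (\<phi>, p)) + \<delta>, snd (lift (\<phi>, p)))"
proof -
  have "next_angle (\<phi> + \<delta>) p = next_angle \<phi> p + \<delta>"
    using next_angle[OF assms, of \<phi>] height_rotate[of \<phi> "\<phi> + arccos p" "next_angle \<phi> p"]
    by (intro next_angle_eqI[OF assms]) (simp_all add: algebra_simps)
  then show ?thesis
    by (simp add: lift_def Let_def algebra_simps)
qed

end

section \<open>Passage to the quotient maps\<close>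

lemma quotient_map_lift:
  assumes rotate: "\<And>t. \<Gamma> (t + 2 * pi / real n) = cis (2 * pi / real n) * \<Gamma> t"
    and y: "\<bar>snd y\<bar> < 1"
  shows "quotient_map \<Gamma> n m (quot_class n m (phase_of y)) = quot_class n m (phase_of (lift y))"
proof -
  \<comment> \<open>All representatives of a class differ by rotations that commute with
    \<open>lift\<close>, so the union in \<open>quotient_map\<close> is over equal classes.\<close>
  have "quot_class n m (billiard_map \<Gamma> z) = quot_class n m (phase_of (lift y))"
    if z: "z \<in> quot_class n m (phase_of y)" for z
  proof -
    obtain j :: int where j: "z = phase_of (fst y + 2 * real m * pi / real n * of_int j, snd y)"
      using z unfolding quot_class_def mem_Collect_eq quot_equiv_phase_of by blast
    define \<delta> where "\<delta> = 2 * real m * pi / real n * of_int j"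
    have \<delta>: "\<delta> = 2 * pi / real n * of_int (int m * j)"
      by (simp add: \<delta>_def)
    have "billiard_map \<Gamma> z = phase_of (lift (fst y + \<delta>, snd y))"
      unfolding j \<delta>_def[symmetric] using y by (intro billiard_map_lift) simp
    also have "lift (fst y + \<delta>, snd y) = (fst (lift y) + \<delta>, snd (lift y))"
      using lift_rotate[OF rotate_int[OF rotate, of _ "int m * j"] y, of "fst y"] by (simp add: \<delta>)
    finally have "quot_equiv n m (phase_of (lift y)) (billiard_map \<Gamma> z)"
      by (auto simp: quot_equiv_phase_of \<delta>_def)
    then show ?thesis
      by (simp flip: quot_class_eq_iff)
  qed
  moreover have "phase_of y \<in> quot_class n m (phase_of y)"
    by (simp add: quot_class_def quot_equiv_def)
  ultimately show ?thesis
    unfolding quotient_map_def by blast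
qed

text \<open>The lift moves \<open>x\<close> by \<open>2 * m * pi / n\<close>. Translating back gives
  a local lift fixing \<open>x\<close>, with the same classes and the same derivative.\<close>

lemma quotient_derivative_lift:
  assumes rotate: "\<And>t. \<Gamma> (t + 2 * pi / real n) = cis (2 * pi / real n) * \<Gamma> t"
    and x: "\<bar>snd x\<bar> < 1" "lift x = (fst x + 2 * real m * pi / real n, snd x)"
    and D: "(lift has_derivative D) (at x)"
  shows "quotient_derivative \<Gamma> n m x D"
  unfolding quotient_derivative_def
proof (intro exI conjI)
  define \<theta> where "\<theta> = 2 * real m * pi / real n"
  define F where "F = (\<lambda>y. lift y - (\<theta>, 0))"
  show "F x = x"
    by (simp add: F_def \<theta>_def x prod_eq_iff)
  show "(F has_derivative D) (at x)"
    unfolding F_def using has_derivative_diff[OF D has_derivative_const] by simp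
  have "open {y::real \<times> real. \<bar>snd y\<bar> < 1}"
    by (intro open_Collect_less continuous_intros)
  then have "\<forall>\<^sub>F y in nhds x. y \<in> {y. \<bar>snd y\<bar> < 1}"
    by (rule eventually_nhds_in_open) (simp add: x)
  then show "\<forall>\<^sub>F y in nhds x.
      quot_class n m (phase_of (F y)) = quotient_map \<Gamma> n m (quot_class n m (phase_of y))"
  proof eventually_elim
    case (elim y)
    have "phase_of (lift y) = phase_of (fst (F y) + \<theta> * of_int 1, snd (F y))"
      by (simp add: F_def)
    then have "quot_equiv n m (phase_of (F y)) (phase_of (lift y))"
      unfolding quot_equiv_phase_of \<theta>_def by blast
    then show ?case
      using elim quotient_map_lift[OF rotate] by (simp flip: quot_class_eq_iff)
  qed
qed

section \<open>The type of the fixed points\<close>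

lemma fixed_point_type:
  assumes rotate: "\<And>t. \<Gamma> (t + 2 * pi / real n) = cis (2 * pi / real n) * \<Gamma> t"
    and m: "1 \<le> m" "m < n"
    and crit: "inner (\<Gamma> \<phi>) (cis \<phi>) = 0"
  defines "x \<equiv> (\<phi>, cos (real m * pi / real n))"
  shows "elliptic_fixed_point \<Gamma> n m x \<longleftrightarrow> support_fun \<Gamma> \<phi> < \<rho> \<phi>"
    and "hyperbolic_fixed_point \<Gamma> n m x \<longleftrightarrow> \<rho> \<phi> < support_fun \<Gamma> \<phi>"
proof -
  define g where "g = support_fun \<Gamma> \<phi>"
  define \<delta> where "\<delta> = 2 * pi / real n"
  define \<alpha> where "\<alpha> = real m * pi / real n"
  define r where "r = \<rho> \<phi> / (2 * g)"
  have \<alpha>: "0 < \<alpha>" "\<alpha> < pi"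
    using m by (simp_all add: \<alpha>_def field_simps)
  have \<alpha>_\<delta>: "2 * \<alpha> = \<delta> * of_int (int m)"
    by (simp add: \<alpha>_def \<delta>_def)
  have rot: "\<Gamma> (t + \<delta>) = cis \<delta> * \<Gamma> t" for t
    unfolding \<delta>_def by (rule rotate)
  have rot_m: "\<Gamma> (t + 2 * \<alpha>) = cis (2 * \<alpha>) * \<Gamma> t" for t
    unfolding \<alpha>_\<delta> by (rule rotate_int[OF rot])
  have start: "\<Gamma> \<phi> = - (g *\<^sub>R inward_normal \<phi>)"
    using orthonormal_decomposition[of "\<Gamma> \<phi>" \<phi>] by (simp add: crit g_def support_fun_def)
  have stop: "\<Gamma> (\<phi> + 2 * \<alpha>) = - (g *\<^sub>R inward_normal (\<phi> + 2 * \<alpha>))"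
    by (simp add: rot_m start inward_normal_add)
  \<comment> \<open>Positivity of \<open>g\<close> comes from convexity: the rotated point lies
    strictly above the tangent at \<open>\<phi>\<close>, at height
    \<open>g * (1 - cos \<delta>)\<close>.\<close>
  have "0 < \<delta>" "\<delta> < 2 * pi"
    using m by (simp_all add: \<delta>_def field_simps)
  then have "height \<phi> \<phi> (\<phi> + \<delta>) > 0"
    by (intro height_tangent_pos) auto
  moreover have "height \<phi> \<phi> (\<phi> + \<delta>) = g * (1 - cos \<delta>)"
  proof -
    have "inner (inward_normal (\<phi> + \<delta>)) (inward_normal \<phi>) = cos \<delta>"
      "inner (inward_normal \<phi>) (inward_normal \<phi>) = 1"
      using inner_rotate[of "pi / 2" "cis (\<phi> + \<delta>)" "cis \<phi>"] inner_rotate[of "pi / 2" "cis \<phi>" "cis \<phi>"]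
      by (simp_all add: inward_normal_eq inner_cis_cis)
    moreover have "\<Gamma> (\<phi> + \<delta>) = - (g *\<^sub>R inward_normal (\<phi> + \<delta>))"
      by (simp add: rot start inward_normal_add)
    ultimately show ?thesis
      by (simp add: height_def start inner_diff_left right_diff_distrib)
  qed
  ultimately have "g > 0"
    using cos_le_one[of \<delta>] by (simp add: zero_less_mult_iff)
  then have "r > 0"
    using speed_pos by (simp add: r_def)
  define D where "D = (\<lambda>h::real \<times> real. let b = ((1 - r) * fst h - snd h / sin \<alpha>) / r
      in (b, - sin \<alpha> * ((1 - r) * b - r * fst h)))"
  have lift: "lift (\<phi>, cos \<alpha>) = (\<phi> + 2 * \<alpha>, cos \<alpha>)"
    and lift': "(lift has_derivative D) (at (\<phi>, cos \<alpha>))"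
    unfolding D_def r_def
    by (rule lift_derivative[OF \<alpha> \<open>g > 0\<close> start stop speed_rotate[OF rot_m]])+
  have sin: "sin \<alpha> > 0"
    using \<alpha> by (simp add: sin_gt_zero)
  have "\<bar>cos \<alpha>\<bar> < 1"
    using \<alpha> cos_monotone_0_pi[of 0 \<alpha>] cos_monotone_0_pi[of \<alpha> pi] by auto
  then have D: "quotient_derivative \<Gamma> n m x D"
    using lift lift' rotate
    by (intro quotient_derivative_lift) (simp_all add: x_def mult.assoc flip: \<alpha>_def, simp add: \<alpha>_def)
  \<comment> \<open>Uniqueness of the derivative turns the existential in both definitions into a
    statement about \<open>D\<close>.\<close>
  have unique: "(\<exists>E. quotient_derivative \<Gamma> n m x E \<and> P E) \<longleftrightarrow> P D" for P
    using D quotient_derivative_unique[of n \<Gamma> m x] m by (metis less_nat_zero_code neq0_conv)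
  have entries: "fst (D (1, 0)) = (1 - r) / r" "snd (D (0, 1)) = (1 - r) / r"
    "fst (D (0, 1)) * snd (D (1, 0)) = ((1 - r) / r)\<^sup>2 - 1"
    using sin \<open>r > 0\<close> by (simp_all add: D_def Let_def field_simps power2_eq_square)
  have "\<bar>(1 - r) / r\<bar> < 1 \<longleftrightarrow> g < \<rho> \<phi>" "\<bar>(1 - r) / r\<bar> > 1 \<longleftrightarrow> \<rho> \<phi> < g"
  proof -
    \<comment> \<open>Since \<open>(1 - r) / r = 1 / r - 1\<close> exceeds -1, only the comparison
      with 1 matters; moreover \<open>2 * r = \<rho> \<phi> / g\<close>.\<close>
    have "\<bar>(1 - r) / r\<bar> < 1 \<longleftrightarrow> 1 < 2 * r" "\<bar>(1 - r) / r\<bar> > 1 \<longleftrightarrow> 2 * r < 1"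
      using \<open>r > 0\<close> by (auto simp: abs_less_iff less_divide_eq divide_less_eq abs_if)
    then show "\<bar>(1 - r) / r\<bar> < 1 \<longleftrightarrow> g < \<rho> \<phi>" "\<bar>(1 - r) / r\<bar> > 1 \<longleftrightarrow> \<rho> \<phi> < g"
      using \<open>g > 0\<close> by (simp_all add: r_def field_simps)
  qed
  then show "elliptic_fixed_point \<Gamma> n m x \<longleftrightarrow> support_fun \<Gamma> \<phi> < \<rho> \<phi>"
    and "hyperbolic_fixed_point \<Gamma> n m x \<longleftrightarrow> \<rho> \<phi> < support_fun \<Gamma> \<phi>"
    unfolding elliptic_fixed_point_def hyperbolic_fixed_point_def unique
      unimodular_eigenvalues[OF entries] by (simp_all add: g_def)
qed

end

section \<open>Application to symmetric ovals\<close>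

lemma oval_angle_parametrized:
  assumes "oval \<Gamma>"
  shows "angle_parametrized \<Gamma> (\<lambda>t. norm (vector_derivative \<Gamma> (at t)))"
proof
  fix t
  have "\<forall>k. ((\<lambda>f s. vector_derivative f (at s)) ^^ k) \<Gamma> differentiable (at t)"
    using assms by (simp add: oval_def smooth_curve_def)
  \<comment> \<open>The instance \<open>k = 0\<close> of smoothness.\<close>
  then have "\<Gamma> differentiable (at t)"
    by (metis funpow_0)
  then show "(\<Gamma> has_vector_derivative norm (vector_derivative \<Gamma> (at t)) *\<^sub>R cis t) (at t)"
    using assms by (metis oval_def tangent_def vector_derivative_works)
qed (use assms in \<open>auto simp: oval_def\<close>)

theorem proposition4p1:
  fixes n :: nat and \<Gamma> :: "real \<Rightarrow> complex" and \<phi>\<^sub>0 :: real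
  assumes "n \<ge> 2"
    and "\<Gamma> \<in> symmetric_ovals n"
    and "critical_point (support_fun \<Gamma>) \<phi>\<^sub>0"
  shows "\<forall>orb \<in> symmetric_orbits \<Gamma> n \<phi>\<^sub>0.
           (elliptic_orbit \<Gamma> n \<phi>\<^sub>0 orb \<longleftrightarrow> nondegenerate_minimum (support_fun \<Gamma>) \<phi>\<^sub>0) \<and>
           (hyperbolic_orbit \<Gamma> n \<phi>\<^sub>0 orb \<longleftrightarrow> nondegenerate_maximum (support_fun \<Gamma>) \<phi>\<^sub>0)"
proof -
  define \<rho> where "\<rho> = (\<lambda>t. norm (vector_derivative \<Gamma> (at t)))"
  interpret angle_parametrized \<Gamma> \<rho>
    unfolding \<rho>_def using assms(2) by (intro oval_angle_parametrized) (simp add: symmetric_ovals_def)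
  have rotate: "\<Gamma> (t + 2 * pi / real n) = cis (2 * pi / real n) * \<Gamma> t" for t
    using assms(2) by (intro rotate_eqI) (simp add: symmetric_ovals_def)
  have crit: "inner (\<Gamma> \<phi>\<^sub>0) (cis \<phi>\<^sub>0) = 0"
    using assms(3) support_fun_deriv[of \<phi>\<^sub>0] DERIV_unique unfolding critical_point_def by blast
  \<comment> \<open>With second derivative \<open>\<rho> - g\<close>, the test compares
    \<open>\<rho>\<close> with \<open>g\<close> at the critical point, as
    \<open>fixed_point_type\<close> does.\<close>
  note test = second_derivative_test[OF support_fun_deriv crit support_fun_deriv2]
  have type: "elliptic_fixed_point \<Gamma> n m (orbit_point n \<phi>\<^sub>0 m k)
        \<longleftrightarrow> nondegenerate_minimum (support_fun \<Gamma>) \<phi>\<^sub>0"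
      "hyperbolic_fixed_point \<Gamma> n m (orbit_point n \<phi>\<^sub>0 m k)
        \<longleftrightarrow> nondegenerate_maximum (support_fun \<Gamma>) \<phi>\<^sub>0"
    if "(m, k) \<in> orbit_index n" for m k
  proof -
    \<comment> \<open>The point \<open>\<phi>\<close> is \<open>\<phi>\<^sub>0\<close> rotated
      \<open>k\<close> times; symmetry transports the speed, the support function and
      criticality.\<close>
    define \<phi> where "\<phi> = \<phi>\<^sub>0 + 2 * pi / real n * of_int (int k)"
    have point: "orbit_point n \<phi>\<^sub>0 m k = (\<phi>, cos (real m * pi / real n))"
      by (simp add: orbit_point_def \<phi>_def)
    note rotate_k = rotate_int[OF rotate, of _ "int k"]
    have "\<rho> \<phi> = \<rho> \<phi>\<^sub>0" "support_fun \<Gamma> \<phi> = support_fun \<Gamma> \<phi>\<^sub>0" "inner (\<Gamma> \<phi>) (cis \<phi>) = 0"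
      unfolding \<phi>_def using crit speed_rotate[OF rotate_k] support_fun_rotate[OF rotate_k]
        inner_tangent_rotate[OF rotate_k] by simp_all
    moreover have "1 \<le> m" "m < n"
      using that assms(1) by (auto simp: orbit_index_def)
    ultimately show "elliptic_fixed_point \<Gamma> n m (orbit_point n \<phi>\<^sub>0 m k)
        \<longleftrightarrow> nondegenerate_minimum (support_fun \<Gamma>) \<phi>\<^sub>0"
      "hyperbolic_fixed_point \<Gamma> n m (orbit_point n \<phi>\<^sub>0 m k)
        \<longleftrightarrow> nondegenerate_maximum (support_fun \<Gamma>) \<phi>\<^sub>0"
      using fixed_point_type[OF rotate, of m \<phi>] unfolding point test by auto
  qed
  \<comment> \<open>The criterion is the same for all index pairs, so it is immaterial which pair
    represents a given orbit.\<close>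
  show ?thesis
    unfolding symmetric_orbits_def elliptic_orbit_def hyperbolic_orbit_def
    using type by blast
qed

end
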